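(* Fix $p>1$, and let $u$ be a weight on $\mathbb R^n$. If $u\in A_p^{\mathcal R}$, then for every measurable function $f$ on $\mathbb R^n$, $$\left\Vert\frac{M(fu)}{u}\right\Vert_{L^{p',\infty}(u)}\leq c_{n,p}\,[u]_{A_p^{\mathcal R}}^{p+1}\,\Vert f\Vert_{L^{p',1}(u)},$$ where $c_{n,p}>0$ depends only on $n$ and $p$. Moreover, if for some constant $C>0$ the inequality $$\left\Vert\frac{M(fu)}{u}\right\Vert_{L^{p',\infty}(u)}\leq C\,\Vert f\Vert_{L^{p',1}(u)}$$ holds for every measurable function $f$, then $u\in A_p^{\mathcal R}$, and $[u]_{A_p^{\mathcal R}}\leq p'C$.
   Context: A weight is a positive, locally integrable function on $\mathbb R^n$. Cubes have sides parallel to the axes. For a weight $w$ and a measurable set $E$, $w(E)=\int_E w(x)\,dx$, and $\frac1p+\frac1{p'}=1$. The Hardy-Littlewood maximal operator is $Mf(x)=\sup_{Q\ni x}\frac1{|Q|}\int_Q|f|$, the supremum being over all cubes $Q$ containing $x$. For a weight $w$ (identified with the measure $w(x)\,dx$), put $\lambda_f^w(y)=w(\{x:|f(x)|>y\})$. For $q>0$: $\Vert f\Vert_{L^{q,1}(w)}=q\int_0^\infty \lambda_f^w(y)^{1/q}\,dy$ and $\Vert f\Vert_{L^{q,\infty}(w)}=\sup_{y>0} y\,\lambda_f^w(y)^{1/q}$. $w\in A_p^{\mathcal R}$ means $[w]_{A_p^{\mathcal R}}=\sup_Q w(Q)^{1/p}\,\frac{\Vert \chi_Q w^{-1}\Vert_{L^{p',\infty}(w)}}{|Q|}<\infty$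 (supremum over all cubes). *)

theory Defs
  imports "HOL-Analysis.Analysis"
begin

text \<open>
  All norms and constants below live in \<^typ>\<open>ennreal\<close>, since they (and the maximal function) may
  be infinite. Only integrals, distribution functions and norms of absolute values occur, so the
  functions measured are represented by their \<^typ>\<open>ennreal\<close>-valued modulus.
  ``Measurable'' always means Lebesgue measurable.
\<close>

text \<open>Intended for exponents \<open>a > 0\<close>, where \<open>0\<^sup>a = 0\<close> and \<open>\<infinity>\<^sup>a = \<infinity>\<close>.\<close>

definition ennpow :: "ennreal \<Rightarrow> real \<Rightarrow> ennreal" where
  "ennpow x a = (if x = \<infinity> then \<infinity> else ennreal (enn2real x powr a))"

text \<open>The solution \<open>p'\<close> of \<open>1/p + 1/p' = 1\<close>.\<close>

definition conj_exp :: "real \<Rightarrow> real" where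
  "conj_exp p = p / (p - 1)"

definition cubes :: "(real ^ 'n::finite) set set" where
  "cubes = {cbox a (\<chi> i. a $ i + l) | a l. 0 < l}"

definition weight :: "(real ^ 'n::finite \<Rightarrow> real) \<Rightarrow> bool" where
  "weight w \<longleftrightarrow> w \<in> borel_measurable lebesgue \<and> (\<forall>x. 0 < w x)
     \<and> (\<forall>K. compact K \<longrightarrow> w absolutely_integrable_on K)"

definition weight_measure :: "(real ^ 'n::finite \<Rightarrow> real) \<Rightarrow> (real ^ 'n) measure" where
  "weight_measure w = density lebesgue (\<lambda>x. ennreal (w x))"

definition maximal :: "(real ^ 'n::finite \<Rightarrow> real) \<Rightarrow> real ^ 'n \<Rightarrow> ennreal" where
  "maximal f x = (SUP Q\<in>{Q \<in> cubes. x \<in> Q}.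
     (\<integral>\<^sup>+ y\<in>Q. ennreal \<bar>f y\<bar> \<partial>lebesgue) / emeasure lebesgue Q)"

text \<open>Here \<open>F\<close> plays the role of \<open>\<bar>f\<bar>\<close>.\<close>

definition distr_fun :: "(real ^ 'n::finite \<Rightarrow> real) \<Rightarrow> (real ^ 'n \<Rightarrow> ennreal) \<Rightarrow> real \<Rightarrow> ennreal" where
  "distr_fun w F y = emeasure (weight_measure w) {x. F x > ennreal y}"

definition lorentz_1 :: "real \<Rightarrow> (real ^ 'n::finite \<Rightarrow> real) \<Rightarrow> (real ^ 'n \<Rightarrow> ennreal) \<Rightarrow> ennreal" where
  "lorentz_1 q w F = ennreal q * (\<integral>\<^sup>+ y\<in>{0<..}. ennpow (distr_fun w F y) (1 / q) \<partial>lborel)"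

definition lorentz_inf :: "real \<Rightarrow> (real ^ 'n::finite \<Rightarrow> real) \<Rightarrow> (real ^ 'n \<Rightarrow> ennreal) \<Rightarrow> ennreal" where
  "lorentz_inf q w F = (SUP y\<in>{0<..}. ennreal y * ennpow (distr_fun w F y) (1 / q))"

definition ApR_const :: "real \<Rightarrow> (real ^ 'n::finite \<Rightarrow> real) \<Rightarrow> ennreal" where
  "ApR_const p w = (SUP Q\<in>cubes.
     ennpow (emeasure (weight_measure w) Q) (1 / p)
     * (lorentz_inf (conj_exp p) w (\<lambda>x. ennreal (indicator Q x * inverse (w x)))
        / emeasure lebesgue Q))"

definition ApR :: "real \<Rightarrow> (real ^ 'n::finite \<Rightarrow> real) set" where
  "ApR p = {w. weight w \<and> ApR_const p w < \<infinity>}"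

end

theory Submission
  imports Defs
begin

text \<open>
  Write \<open>\<nu>\<close> for the measure with density \<open>u\<close> and \<open>q\<close> for the exponent conjugate to \<open>p\<close>. The
  condition \<open>A\<^sub>p\<^sup>\<R>\<close> enters only through the inequality
  \<open>|E| / |Q| \<le> A (\<nu> E / \<nu> Q)\<^sup>1\<^sup>/\<^sup>p\<close> for measurable \<open>E \<subseteq> Q\<close>, where \<open>A\<close> is a multiple of the
  \<open>A\<^sub>p\<^sup>\<R>\<close> constant. It follows by writing \<open>|E|\<close> as the \<open>\<nu>\<close>-integral of \<open>1 / u\<close> over \<open>E\<close> and
  estimating this integral by the weak \<open>L\<^sup>q\<close> norm of \<open>1 / u\<close> on \<open>Q\<close>
  (\<open>ApR_restricted_inequality\<close>).

  The upper bound is dual to a restricted weak type estimate: for \<open>\<nu> F < \<infinity>\<close> it suffices to bound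
  \<open>\<integral>\<^sub>F M(f u) dx\<close> by \<open>C \<parallel>f\<parallel> \<nu>(F)\<^sup>1\<^sup>/\<^sup>p\<close>, the norm being that of \<open>L\<^sup>q\<^sup>,\<^sup>1(\<nu>)\<close>, because on the level set
  \<open>F\<close> of \<open>M(f u) / u\<close> at height \<open>y\<close> the integral is at least \<open>y \<nu>(F)\<close>. Since finitely many shifted
  dyadic grids capture all cubes (\<open>cube_in_grid_cell\<close>), \<open>M\<close> may be replaced by the maximal operator
  of a laminar family, that is, a family in which any two members are nested or disjoint.

  For such a family the estimate is obtained in three steps, each with a geometric series.

  \<^item> Take \<open>f = 1\<close> and let the family be finite (\<open>nn_integral_family_sup_density\<close>). On a maximal
    member \<open>R\<close> the maximal function is at most twice the density \<open>\<nu> R / |R|\<close>, except for the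
    contribution of the members of density at least twice as large. The union of these has at most
    half the Lebesgue measure of \<open>R\<close>, so the rest \<open>E\<close> of \<open>R\<close> satisfies \<open>\<nu> E \<ge> (2 A)\<^sup>-\<^sup>p \<nu> R\<close>. An
    induction on the family therefore loses a factor smaller than 1 at each generation. One power
    of \<open>A\<close> comes from comparing \<open>|F \<inter> R|\<close> with \<open>\<nu>(F \<inter> R)\<close> and \<open>p\<close> powers come from summing the
    generations; this is the source of the exponent \<open>p + 1\<close>.

  \<^item> For \<open>f\<close> the indicator of a set \<open>E\<close>, sort the members \<open>Q\<close> by the size of \<open>\<nu>(E \<inter> Q) / \<nu> Q\<close>
    (\<open>nn_integral_family_sup_set\<close>). The members where this exceeds \<open>2\<^sup>-\<^sup>k\<close> cover a set of measure at
    most \<open>2\<^sup>k \<nu> E\<close>.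

  \<^item> A general \<open>f\<close> is a sum of multiples of indicators of its level sets at powers of 2, and
    \<open>L\<^sup>q\<^sup>,\<^sup>1\<close> is exactly the norm that sums the resulting bounds
    (\<open>nn_integral_family_sup_function\<close>).

  For the converse, test the assumed inequality on \<open>f = \<chi>\<^sub>Q\<close>: its \<open>L\<^sup>q\<^sup>,\<^sup>1\<close> norm is \<open>q \<nu>(Q)\<^sup>1\<^sup>/\<^sup>q\<close>, while
  \<open>M(u \<chi>\<^sub>Q) \<ge> \<nu> Q / |Q|\<close> on \<open>Q\<close>. What remains to be checked is that \<open>M(u \<chi>\<^sub>Q)\<close> is measurable, which
  holds because it is lower semicontinuous.
\<close>

section \<open>Inequalities for weighted geometric means\<close>

lemma weighted_geometric_mean_le:
  fixes a b s t :: real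
  assumes "0 < s" "0 < t" "s + t = 1" "0 \<le> a" "0 \<le> b"
  shows "a powr s * b powr t \<le> s * a + t * b"
proof (cases "a = 0 \<or> b = 0")
  case True
  then show ?thesis using assms by auto
next
  case False
  then show ?thesis using Youngs_inequality_0[of s t a b] assms by auto
qed

text \<open>
  Hoelder's inequality for finite sums; after normalising both sums to 1 it is the inequality between
  weighted geometric and arithmetic means, applied term by term.
\<close>

lemma sum_powr_mult_le:
  fixes a b :: "'i \<Rightarrow> real"
  assumes fin: "finite I" and st: "0 < s" "0 < t" "s + t = 1"
    and a: "\<And>i. i \<in> I \<Longrightarrow> 0 \<le> a i" and b: "\<And>i. i \<in> I \<Longrightarrow> 0 \<le> b i"
  shows "(\<Sum>i\<in>I. a i powr s * b i powr t) \<le> sum a I powr s * sum b I powr t"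
proof (cases "sum a I \<noteq> 0 \<and> sum b I \<noteq> 0")
  case True
  then have pos: "0 < sum a I" "0 < sum b I"
    using sum_nonneg[of I a] sum_nonneg[of I b] a b by fastforce+
  have "(\<Sum>i\<in>I. a i powr s * b i powr t)
      = (sum a I powr s * sum b I powr t) * (\<Sum>i\<in>I. (a i / sum a I) powr s * (b i / sum b I) powr t)"
    unfolding sum_distrib_left
    by (rule sum.cong[OF refl]) (use a b pos in \<open>simp add: powr_divide field_simps\<close>)
  also have "\<dots> \<le> (sum a I powr s * sum b I powr t) * (\<Sum>i\<in>I. s * (a i / sum a I) + t * (b i / sum b I))"
    by (intro mult_left_mono sum_mono weighted_geometric_mean_le mult_nonneg_nonneg)
       (use a b pos st in auto)
  also have "(\<Sum>i\<in>I. s * (a i / sum a I) + t * (b i / sum b I)) = s * (sum a I / sum a I) + t * (sum b I / sum b I)"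
    unfolding sum.distrib sum_distrib_left[symmetric] sum_divide_distrib[symmetric] ..
  also have "\<dots> = 1" using pos st by simp
  finally show ?thesis by simp
next
  case False
  have "a i powr s * b i powr t = 0" if "i \<in> I" for i
  proof -
    have "a i = 0 \<or> b i = 0"
      using False that a b fin sum_nonneg_eq_0_iff[of I a] sum_nonneg_eq_0_iff[of I b] by blast
    then show ?thesis by auto
  qed
  then have "(\<Sum>i\<in>I. a i powr s * b i powr t) = 0" by (intro sum.neutral) blast
  then show ?thesis by simp
qed

section \<open>Laminar families\<close>

definition laminar :: "'a set set \<Rightarrow> bool" where
  "laminar D \<longleftrightarrow> (\<forall>P\<in>D. \<forall>Q\<in>D. P \<inter> Q = {} \<or> P \<subseteq> Q \<or> Q \<subseteq> P)"

lemma laminar_subset: "laminar D \<Longrightarrow> D' \<subseteq> D \<Longrightarrow> laminar D'"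
  unfolding laminar_def by blast

lemma laminar_maximal_members:
  assumes "finite D" "laminar D"
  obtains T where "T \<subseteq> D" "disjoint T" "\<And>Q. Q \<in> D \<Longrightarrow> \<exists>R\<in>T. Q \<subseteq> R"
proof
  let ?T = "{R \<in> D. \<forall>Q\<in>D. R \<subseteq> Q \<longrightarrow> R = Q}"
  show "?T \<subseteq> D" by blast
  show "disjoint ?T"
  proof (rule disjointI)
    fix P Q assume PQ: "P \<in> ?T" "Q \<in> ?T" "P \<noteq> Q"
    then have "P \<inter> Q = {} \<or> P \<subseteq> Q \<or> Q \<subseteq> P"
      using assms(2) unfolding laminar_def by simp
    then show "P \<inter> Q = {}" using PQ by auto
  qed
  show "\<exists>R\<in>?T. Q \<subseteq> R" if "Q \<in> D" for Q
    using finite_has_maximal2[OF assms(1) that] by blast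
qed

lemma measure_Union_maximal:
  assumes T: "T \<subseteq> D" "disjoint T" "\<And>Q. Q \<in> D \<Longrightarrow> \<exists>R\<in>T. Q \<subseteq> R"
    and fin: "finite D" and meas: "\<And>Q. Q \<in> D \<Longrightarrow> Q \<in> fmeasurable M" and E: "E \<in> sets M"
  shows "measure M (E \<inter> \<Union>D) = (\<Sum>R\<in>T. measure M (E \<inter> R))"
proof -
  have "E \<inter> \<Union>D = (\<Union>R\<in>T. E \<inter> R)" using T by blast
  also have "measure M \<dots> = (\<Sum>R\<in>T. measure M (E \<inter> R))"
  proof (rule measure_UNION')
    show "finite T" using T(1) fin finite_subset by blast
    show "E \<inter> R \<in> fmeasurable M" if "R \<in> T" for R
      using that T(1) meas E fmeasurable_Int_fmeasurable[of R M E] by (auto simp: Int_commute)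
    show "pairwise (\<lambda>i j. disjnt (E \<inter> i) (E \<inter> j)) T"
      using T(2) by (auto simp: pairwise_def disjnt_def disjoint_def)
  qed
  finally show ?thesis .
qed

text \<open>
  The weak type (1,1) estimate for a maximal operator in its combinatorial form. It holds with constant
  1 for any two measures, since the maximal members are disjoint and already cover the union.
\<close>

lemma laminar_weak_type:
  assumes fin: "finite D" and lam: "laminar D"
    and meas: "\<And>Q. Q \<in> D \<Longrightarrow> Q \<in> fmeasurable M" "\<And>Q. Q \<in> D \<Longrightarrow> Q \<in> fmeasurable N"
    and E: "E \<in> sets N"
    and le: "\<And>Q. Q \<in> D \<Longrightarrow> a * measure M Q \<le> measure N (E \<inter> Q)"
  shows "a * measure M (\<Union>D) \<le> measure N (E \<inter> \<Union>D)"
proof -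
  obtain T where T: "T \<subseteq> D" "disjoint T" "\<And>Q. Q \<in> D \<Longrightarrow> \<exists>R\<in>T. Q \<subseteq> R"
    using laminar_maximal_members[OF fin lam] by blast
  have M: "measure M (\<Union>D) = (\<Sum>R\<in>T. measure M R)"
  proof -
    have "measure M (\<Union>T) = (\<Sum>R\<in>T. measure M R)"
      using T(1,2) meas(1) fin
      by (intro measure_Union' ) (auto simp: pairwise_def disjnt_def disjoint_def dest: finite_subset)
    moreover have "\<Union>T = \<Union>D" using T by blast
    ultimately show ?thesis by simp
  qed
  have N: "measure N (E \<inter> \<Union>D) = (\<Sum>R\<in>T. measure N (E \<inter> R))"
    by (rule measure_Union_maximal[OF T fin meas(2) E])
  show ?thesis
    unfolding M N sum_distrib_left
  proof (rule sum_mono)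
    show "a * measure M R \<le> measure N (E \<inter> R)" if "R \<in> T" for R
      using le[of R] that T(1) by auto
  qed
qed

section \<open>Maximal functions of laminar families of cubes\<close>

text \<open>
  For \<open>c Q\<close> the average of a function over \<open>Q\<close>, this is its maximal function relative to the family
  \<open>D\<close>; at points outside of all members it is 0.
\<close>

definition family_sup :: "'a set set \<Rightarrow> ('a set \<Rightarrow> ennreal) \<Rightarrow> 'a \<Rightarrow> ennreal" where
  "family_sup D c x = (SUP Q\<in>D. c Q * indicator Q x)"

lemma family_sup_upper: "Q \<in> D \<Longrightarrow> x \<in> Q \<Longrightarrow> c Q \<le> family_sup D c x"
  unfolding family_sup_def by (rule SUP_upper2[of Q]) auto

lemma family_sup_least:
  assumes "\<And>Q. Q \<in> D \<Longrightarrow> x \<in> Q \<Longrightarrow> c Q \<le> b"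
  shows "family_sup D c x \<le> b"
  unfolding family_sup_def using assms by (auto intro!: SUP_least simp: indicator_def)

lemma borel_measurable_family_sup [measurable]:
  assumes "countable D" "\<And>Q. Q \<in> D \<Longrightarrow> Q \<in> sets M"
  shows "family_sup D c \<in> borel_measurable M"
  unfolding family_sup_def[abs_def] using assms
  by (intro borel_measurable_SUP borel_measurable_times_ennreal borel_measurable_const
        borel_measurable_indicator) auto

text \<open>
  Only the comparison of the two measures on the members of the family matters for the upper bound.
  In the application \<open>M\<close> is Lebesgue measure, \<open>N\<close> is the measure with density \<open>u\<close>, and \<open>D\<close> is a
  dyadic grid.
\<close>

locale laminar_weight =
  fixes M N :: "'a measure" and D :: "'a set set" and p A :: real
  assumes sets_eq [simp]: "sets N = sets M"
    and p_gt_1: "1 < p"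
    and lam: "laminar D"
    and fmeas: "\<And>Q. Q \<in> D \<Longrightarrow> Q \<in> fmeasurable M" "\<And>Q. Q \<in> D \<Longrightarrow> Q \<in> fmeasurable N"
    and pos: "\<And>Q. Q \<in> D \<Longrightarrow> 0 < measure M Q" "\<And>Q. Q \<in> D \<Longrightarrow> 0 < measure N Q"
    and restricted: "\<And>Q E. Q \<in> D \<Longrightarrow> E \<in> sets M \<Longrightarrow> E \<subseteq> Q \<Longrightarrow>
      measure M E * measure N Q powr (1 / p) \<le> A * measure M Q * measure N E powr (1 / p)"
    and A_ge_1: "1 \<le> A"
begin

definition avg :: "'a set \<Rightarrow> real" where
  "avg Q = measure N Q / measure M Q"

text \<open>
  The value is dictated by \<open>contraction_step\<close>: it solves
  \<open>2 A = density_const * (1 - 1 / p) * (2 A)\<^sup>-\<^sup>p\<close>.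
\<close>

definition density_const :: real where
  "density_const = p / (p - 1) * (2 * A) powr (p + 1)"

lemma density_const_pos: "0 < density_const"
  unfolding density_const_def using p_gt_1 A_ge_1 by simp

lemma avg_pos: "Q \<in> D \<Longrightarrow> 0 < avg Q"
  unfolding avg_def using pos by simp

text \<open>
  By the weak type estimate the members of \<open>S\<close> cover at most half of \<open>R\<close> in the sense of \<open>M\<close>. The
  hypothesis \<open>restricted\<close> for the complement of their union in \<open>R\<close> then prevents this complement
  from being small in the sense of \<open>N\<close>.
\<close>

lemma dense_members_small:
  assumes R: "R \<in> D" and S: "S \<subseteq> D" "finite S"
    and sub: "\<And>Q. Q \<in> S \<Longrightarrow> Q \<subseteq> R" and big: "\<And>Q. Q \<in> S \<Longrightarrow> 2 * avg R \<le> avg Q"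
  shows "measure N (\<Union>S) \<le> (1 - (2 * A) powr (- p)) * measure N R"
proof -
  let ?G = "\<Union>S"
  have "?G \<subseteq> R" using sub by blast
  moreover have "?G \<in> fmeasurable M" "?G \<in> fmeasurable N"
    using S fmeas fmeasurable.finite_Union[of S] by (simp_all add: subset_iff)
  ultimately have G: "?G \<in> fmeasurable M" "?G \<in> fmeasurable N" "?G \<subseteq> R"
    by simp_all
  have Rm: "R \<in> fmeasurable M" "R \<in> fmeasurable N" using fmeas R by auto
  have "2 * avg R * measure M ?G \<le> measure N (R \<inter> ?G)"
  proof (rule laminar_weak_type[OF S(2) laminar_subset[OF lam S(1)]])
    fix Q assume Q: "Q \<in> S"
    then have "R \<inter> Q = Q" using sub by blast
    then show "2 * avg R * measure M Q \<le> measure N (R \<inter> Q)"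
      using big[OF Q] pos[of Q] Q S(1) by (auto simp: avg_def[of Q] field_simps)
  qed (use S fmeas Rm in auto)
  also have "\<dots> \<le> measure N R" by (rule measure_mono_fmeasurable) (use Rm G in auto)
  finally have "2 * measure M ?G \<le> measure M R"
    using pos[OF R] by (simp add: avg_def field_simps)
  moreover have "measure M (R - ?G) = measure M R - measure M ?G"
    by (rule measurable_measure_Diff) (use Rm G in auto)
  ultimately have half: "measure M R \<le> 2 * measure M (R - ?G)" by simp
  have "measure M R * measure N R powr (1 / p) \<le> 2 * (measure M (R - ?G) * measure N R powr (1 / p))"
    using half by (simp add: mult_right_mono mult.assoc[symmetric])
  also have "\<dots> \<le> 2 * (A * measure M R * measure N (R - ?G) powr (1 / p))"
    by (intro mult_left_mono restricted) (use R Rm G in auto)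
  finally have "measure M R * measure N R powr (1 / p) \<le> measure M R * (2 * A * measure N (R - ?G) powr (1 / p))"
    by (simp add: ac_simps)
  then have "measure N R powr (1 / p) \<le> 2 * A * measure N (R - ?G) powr (1 / p)"
    using pos[OF R] by simp
  then have "(measure N R powr (1 / p)) powr p \<le> (2 * A * measure N (R - ?G) powr (1 / p)) powr p"
    using p_gt_1 by (intro powr_mono2) auto
  then have "measure N R \<le> (2 * A) powr p * measure N (R - ?G)"
    using p_gt_1 A_ge_1 by (simp add: powr_mult powr_powr)
  then have "(2 * A) powr (- p) * measure N R \<le> measure N (R - ?G)"
    using A_ge_1 by (simp add: powr_minus field_simps)
  also have "\<dots> = measure N R - measure N ?G"
    by (rule measurable_measure_Diff) (use Rm G in auto)
  finally show ?thesis by (simp add: algebra_simps)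
qed

text \<open>
  The induction step of the next estimate in terms of numbers: with \<open>e = (2 A)\<^sup>-\<^sup>p\<close> and \<open>t = 1 - 1 / p\<close>
  one has \<open>(1 - e)\<^sup>t \<le> 1 - t e\<close>, and the gain \<open>t e\<close> pays for the term \<open>2 A\<close>.
\<close>

lemma contraction_step:
  assumes "0 \<le> g" "0 \<le> r" "g \<le> (1 - (2 * A) powr (- p)) * r"
  shows "2 * A * r powr (1 - 1 / p) + density_const * g powr (1 - 1 / p) \<le> density_const * r powr (1 - 1 / p)"
proof -
  let ?e = "(2 * A) powr (- p)" and ?t = "1 - 1 / p"
  have t: "0 < ?t" using p_gt_1 by simp
  have e: "0 < ?e" "?e \<le> 1" using A_ge_1 p_gt_1
    by (auto simp: powr_minus field_simps intro!: ge_one_powr_ge_zero)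
  have "g powr ?t \<le> ((1 - ?e) * r) powr ?t"
    using assms t by (intro powr_mono2) auto
  also have "\<dots> = (1 powr (1 / p) * (1 - ?e) powr ?t) * r powr ?t"
    using e assms by (simp add: powr_mult)
  also have "\<dots> \<le> (1 / p * 1 + ?t * (1 - ?e)) * r powr ?t"
    using p_gt_1 t e by (intro mult_right_mono weighted_geometric_mean_le) auto
  also have "1 / p * 1 + ?t * (1 - ?e) = 1 - ?t * ?e" by (simp add: algebra_simps)
  finally have "density_const * g powr ?t \<le> density_const * ((1 - ?t * ?e) * r powr ?t)"
    using density_const_pos by simp
  moreover have "density_const * (?t * ?e) = 2 * A"
  proof -
    have "density_const * (?t * ?e) = (p / (p - 1) * ?t) * ((2 * A) powr (p + 1) * (2 * A) powr (- p))"
      unfolding density_const_def by (simp only: ac_simps)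
    also have "p / (p - 1) * ?t = 1" using p_gt_1 by (simp add: field_simps)
    also have "(2 * A) powr (p + 1) * (2 * A) powr (- p) = 2 * A"
      using A_ge_1 by (simp flip: powr_add)
    finally show ?thesis by simp
  qed
  moreover have "density_const * ((1 - ?t * ?e) * r powr ?t) = density_const * r powr ?t - density_const * (?t * ?e) * r powr ?t"
    by (simp only: left_diff_distrib right_diff_distrib mult_1 mult.assoc)
  ultimately show ?thesis by simp
qed

text \<open>
  The heart of the upper bound. The right-hand side is an off-diagonal product of powers because
  such products add up over the disjoint maximal members by Hoelder's inequality, and because the
  power of \<open>measure N (\<Union>S)\<close> is what shrinks from one generation to the next.
\<close>

lemma nn_integral_family_sup_density:
  assumes "finite S" "S \<subseteq> D" and F: "F \<in> fmeasurable N"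
  shows "(\<integral>\<^sup>+x\<in>F. family_sup S (\<lambda>Q. ennreal (avg Q)) x \<partial>M)
    \<le> ennreal (density_const * measure N F powr (1 / p) * measure N (\<Union>S) powr (1 - 1 / p))"
  using assms
proof (induction S arbitrary: F rule: finite_psubset_induct)
  case (psubset S)
  let ?c = "\<lambda>Q. ennreal (avg Q)"
  have lamS: "laminar S" using lam psubset.prems(1) by (rule laminar_subset)
  obtain T where T: "T \<subseteq> S" "disjoint T" "\<And>Q. Q \<in> S \<Longrightarrow> \<exists>R\<in>T. Q \<subseteq> R"
    using laminar_maximal_members[OF psubset.hyps(1) lamS] by blast
  have finT: "finite T" using T(1) psubset.hyps(1) finite_subset by blast
  have TD: "R \<in> D" if "R \<in> T" for R using that T(1) psubset.prems by blast
  \<comment> \<open>The members that can raise the supremum above twice the density of the maximal member \<open>R\<close>.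
    Since \<open>R\<close> itself is excluded, the induction hypothesis applies to them.\<close>
  define S' where "S' R = {Q \<in> S. Q \<subseteq> R \<and> 2 * avg R \<le> avg Q}" for R
  have S': "S' R \<subset> S" if "R \<in> T" for R
  proof -
    have "R \<notin> S' R" "R \<in> S" using that T(1) avg_pos[OF TD[OF that]] by (auto simp: S'_def)
    then show ?thesis unfolding S'_def by blast
  qed
  have [measurable]: "F \<in> sets M" using psubset.prems(2) by auto
  have Fin: "F \<inter> R \<in> fmeasurable N" "F \<inter> R \<in> fmeasurable M" if "R \<in> T" for R
    using fmeasurable_Int_fmeasurable[of R N F] fmeasurable_Int_fmeasurable[of R M F]
      fmeas[OF TD[OF that]] \<open>F \<in> sets M\<close> by (simp_all add: Int_commute)
  have meas: "family_sup (S' R) ?c \<in> borel_measurable M" if "R \<in> T" for R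
  proof (rule borel_measurable_family_sup)
    show "countable (S' R)"
      using psubset.hyps(1) by (auto intro!: countable_finite simp: S'_def)
    show "Q \<in> sets M" if "Q \<in> S' R" for Q
      using that fmeas(1)[of Q] psubset.prems(1) by (auto simp: S'_def)
  qed
  have pointwise: "family_sup S ?c x * indicator F x
      \<le> (\<Sum>R\<in>T. ennreal (2 * avg R) * indicator (F \<inter> R) x + family_sup (S' R) ?c x * indicator (F \<inter> R) x)"
    (is "_ \<le> (\<Sum>R\<in>T. ?h R x)") for x
  proof (cases "x \<in> F")
    case True
    have "family_sup S ?c x \<le> (\<Sum>R\<in>T. ?h R x)"
    proof (rule family_sup_least)
      fix Q assume Q: "Q \<in> S" "x \<in> Q"
      then obtain R where R: "R \<in> T" "Q \<subseteq> R" using T(3) by blast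
      have "?c Q \<le> ennreal (2 * avg R) + family_sup (S' R) ?c x"
      proof (cases "Q \<in> S' R")
        case True
        then show ?thesis
          using family_sup_upper[OF True Q(2), of ?c] by (intro add_increasing) auto
      next
        case False
        then have "?c Q \<le> ennreal (2 * avg R)"
          using Q R by (auto simp: S'_def intro!: ennreal_leI)
        then show ?thesis by (intro add_increasing2) auto
      qed
      also have "\<dots> = ?h R x" using Q R \<open>x \<in> F\<close> by (auto simp: indicator_def)
      also have "\<dots> \<le> (\<Sum>R\<in>T. ?h R x)"
        using finT R(1) by (intro member_le_sum) auto
      finally show "?c Q \<le> (\<Sum>R\<in>T. ?h R x)" .
    qed
    then show ?thesis using True by simp
  qed simp
  have single: "(\<integral>\<^sup>+x. ?h R x \<partial>M)
      \<le> ennreal (density_const * (measure N (F \<inter> R) powr (1 / p) * measure N R powr (1 - 1 / p)))" if R: "R \<in> T" for R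
  proof -
    have [measurable]: "F \<inter> R \<in> sets M" using Fin[OF R] by auto
    let ?f = "measure N (F \<inter> R) powr (1 / p)" and ?t = "1 - 1 / p"
    have RD: "R \<in> D" by (rule TD[OF R])
    have S'R: "S' R \<subseteq> D" "finite (S' R)"
      using S'[OF R] psubset.prems(1) psubset.hyps(1) finite_subset by blast+
    have "(\<integral>\<^sup>+x. ?h R x \<partial>M) = ennreal (2 * avg R) * emeasure M (F \<inter> R)
        + (\<integral>\<^sup>+x\<in>F \<inter> R. family_sup (S' R) ?c x \<partial>M)"
      using meas[OF R] by (simp add: nn_integral_add nn_integral_cmult_indicator)
    also have "(\<integral>\<^sup>+x\<in>F \<inter> R. family_sup (S' R) ?c x \<partial>M) \<le> ennreal (density_const * ?f * measure N (\<Union>(S' R)) powr ?t)"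
      by (rule psubset.IH[OF S'[OF R] S'R(1) Fin(1)[OF R]])
    also have "ennreal (2 * avg R) * emeasure M (F \<inter> R) = ennreal (2 * avg R * measure M (F \<inter> R))"
      using Fin(2)[OF R] avg_pos[OF RD] by (simp add: emeasure_eq_measure2 ennreal_mult)
    also have "\<dots> + ennreal (density_const * ?f * measure N (\<Union>(S' R)) powr ?t)
        = ennreal (2 * avg R * measure M (F \<inter> R) + density_const * ?f * measure N (\<Union>(S' R)) powr ?t)"
      using avg_pos[OF RD] density_const_pos by (intro ennreal_plus[symmetric]) auto
    also have "\<dots> \<le> ennreal (density_const * (?f * measure N R powr ?t))"
    proof (rule ennreal_leI)
      have "measure M (F \<inter> R) * measure N R powr (1 / p) \<le> A * measure M R * ?f"
        by (rule restricted[OF RD]) auto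
      then have "(measure M (F \<inter> R) * measure N R powr (1 / p)) * (measure N R powr ?t / measure M R)
          \<le> (A * measure M R * ?f) * (measure N R powr ?t / measure M R)"
        by (rule mult_right_mono) (use pos[OF RD] in auto)
      moreover have "measure N R powr (1 / p) * measure N R powr ?t = measure N R"
        using pos[OF RD] by (simp flip: powr_add)
      ultimately have "avg R * measure M (F \<inter> R) \<le> A * ?f * measure N R powr ?t"
        using pos[OF RD] by (simp add: avg_def field_simps)
      moreover have "measure N (\<Union>(S' R)) \<le> (1 - (2 * A) powr (- p)) * measure N R"
        by (rule dense_members_small[OF RD S'R]) (auto simp: S'_def)
      then have "2 * A * measure N R powr ?t + density_const * measure N (\<Union>(S' R)) powr ?t \<le> density_const * measure N R powr ?t"
        by (intro contraction_step) auto
      then have "?f * (2 * A * measure N R powr ?t + density_const * measure N (\<Union>(S' R)) powr ?t) \<le> ?f * (density_const * measure N R powr ?t)"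
        by (rule mult_left_mono) auto
      ultimately show "2 * avg R * measure M (F \<inter> R) + density_const * ?f * measure N (\<Union>(S' R)) powr ?t
          \<le> density_const * (?f * measure N R powr ?t)"
        by (simp add: algebra_simps)
    qed
    finally show ?thesis by (simp add: add_left_mono)
  qed
  have "(\<integral>\<^sup>+x\<in>F. family_sup S ?c x \<partial>M) \<le> (\<integral>\<^sup>+x. (\<Sum>R\<in>T. ?h R x) \<partial>M)"
    by (rule nn_integral_mono) (rule pointwise)
  also have "\<dots> = (\<Sum>R\<in>T. \<integral>\<^sup>+x. ?h R x \<partial>M)"
    using meas Fin by (intro nn_integral_sum) auto
  also have "\<dots> \<le> (\<Sum>R\<in>T. ennreal (density_const * (measure N (F \<inter> R) powr (1 / p) * measure N R powr (1 - 1 / p))))"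
    by (intro sum_mono single)
  also have "\<dots> = ennreal (density_const * (\<Sum>R\<in>T. measure N (F \<inter> R) powr (1 / p) * measure N R powr (1 - 1 / p)))"
    using density_const_pos by (simp add: sum_distrib_left)
  also have "\<dots> \<le> ennreal (density_const * (measure N F powr (1 / p) * measure N (\<Union>S) powr (1 - 1 / p)))"
  proof (intro ennreal_leI mult_left_mono)
    have "(\<Sum>R\<in>T. measure N (F \<inter> R) powr (1 / p) * measure N R powr (1 - 1 / p))
        \<le> (\<Sum>R\<in>T. measure N (F \<inter> R)) powr (1 / p) * (\<Sum>R\<in>T. measure N R) powr (1 - 1 / p)"
      using p_gt_1 finT by (intro sum_powr_mult_le) auto
    also have "(\<Sum>R\<in>T. measure N (F \<inter> R)) = measure N (F \<inter> \<Union>S)"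
      by (rule measure_Union_maximal[symmetric, OF T psubset.hyps(1)])
         (use psubset.prems fmeas in auto)
    also have "(\<Sum>R\<in>T. measure N R) = measure N (\<Union>S)"
    proof -
      have "measure N (space N \<inter> \<Union>S) = (\<Sum>R\<in>T. measure N (space N \<inter> R))"
        by (rule measure_Union_maximal[OF T psubset.hyps(1)])
           (use psubset.prems fmeas sets.top[of N, unfolded sets_eq] in auto)
      moreover have "space N \<inter> R = R" if "R \<in> S" for R
        using sets.sets_into_space[OF fmeasurableD[OF fmeas(2)[of R]]] that psubset.prems(1) by blast
      then have "space N \<inter> \<Union>S = \<Union>S" "(\<Sum>R\<in>T. measure N (space N \<inter> R)) = (\<Sum>R\<in>T. measure N R)"
        using T(1) by (blast, auto intro!: sum.cong)
      ultimately show ?thesis by simp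
    qed
    also have "measure N (F \<inter> \<Union>S) powr (1 / p) \<le> measure N F powr (1 / p)"
    proof (intro powr_mono2 measure_mono_fmeasurable)
      show "F \<inter> \<Union>S \<in> sets N"
        using psubset.prems psubset.hyps(1) fmeas by (auto intro!: sets.Int sets.finite_Union)
    qed (use psubset.prems p_gt_1 in auto)
    finally show "(\<Sum>R\<in>T. measure N (F \<inter> R) powr (1 / p) * measure N R powr (1 - 1 / p))
        \<le> measure N F powr (1 / p) * measure N (\<Union>S) powr (1 - 1 / p)"
      by (simp add: mult_right_mono)
  qed (use density_const_pos in auto)
  finally show ?case by (simp add: mult.assoc)
qed

end

section \<open>Dyadic decompositions of numbers and functions\<close>

lemma term_le_suminf_ennreal: "f k \<le> (\<Sum>i. f i)" for f :: "nat \<Rightarrow> ennreal"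
  using sum_le_suminf[of f "{k}"] by simp

lemma half_power_bracket:
  fixes t :: real
  assumes "0 < t" "t \<le> 1"
  obtains k where "(1 / 2) ^ Suc k < t" "t \<le> (1 / 2) ^ k"
proof
  let ?P = "\<lambda>k. (1 / 2) ^ Suc k < t"
  obtain n where "(1 / 2) ^ n < t" using real_arch_pow_inv[OF assms(1), of "1 / 2"] by auto
  moreover have "(1 / 2 :: real) ^ Suc n \<le> (1 / 2) ^ n" by simp
  ultimately have "?P n" by linarith
  then show "?P (LEAST k. ?P k)" by (rule LeastI)
  show "t \<le> (1 / 2) ^ (LEAST k. ?P k)"
  proof (cases "LEAST k. ?P k")
    case 0
    then show ?thesis using assms by simp
  next
    case (Suc m)
    then have "\<not> ?P m" using not_less_Least[of m ?P] by simp
    then show ?thesis unfolding Suc by simp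
  qed
qed

lemma two_powr_bracket:
  fixes t :: real
  assumes "0 < t"
  obtains k :: int where "2 powr (k - 1) < t" "t \<le> 2 powr k"
proof
  have "real_of_int (\<lceil>log 2 t\<rceil> - 1) < log 2 t" "log 2 t \<le> real_of_int \<lceil>log 2 t\<rceil>" by linarith+
  then have "2 powr (\<lceil>log 2 t\<rceil> - 1) < 2 powr log 2 t" "2 powr log 2 t \<le> 2 powr \<lceil>log 2 t\<rceil>"
    by simp_all
  then show "2 powr (\<lceil>log 2 t\<rceil> - 1) < t" "t \<le> 2 powr \<lceil>log 2 t\<rceil>"
    using assms by simp_all
qed

text \<open>
  The sum is a lower Riemann sum over the intervals from \<open>2\<^sup>k\<^sup>-\<^sup>1\<close> to \<open>2\<^sup>k\<close>, where \<open>k\<close> ranges over the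
  integers, enumerated by \<open>int_decode\<close>.
\<close>

lemma dyadic_sum_le_nn_integral:
  fixes \<phi> :: "real \<Rightarrow> ennreal"
  assumes anti: "\<And>x y. 0 < x \<Longrightarrow> x \<le> y \<Longrightarrow> \<phi> y \<le> \<phi> x"
  shows "(\<Sum>i. ennreal (2 powr (int_decode i - 1)) * \<phi> (2 powr int_decode i))
    \<le> (\<integral>\<^sup>+y\<in>{0<..}. \<phi> y \<partial>lborel)"
proof -
  let ?I = "\<lambda>k::int. {2 powr (k - 1)<..(2::real) powr k}"
  have "(\<Sum>i. ennreal (2 powr (int_decode i - 1)) * \<phi> (2 powr int_decode i))
      = (\<Sum>i. \<integral>\<^sup>+y. \<phi> (2 powr int_decode i) * indicator (?I (int_decode i)) y \<partial>lborel)"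
    by (intro suminf_cong) (simp add: nn_integral_cmult_indicator powr_diff mult.commute)
  also have "\<dots> = (\<integral>\<^sup>+y. (\<Sum>i. \<phi> (2 powr int_decode i) * indicator (?I (int_decode i)) y) \<partial>lborel)"
    by (intro nn_integral_suminf[symmetric]) simp
  also have "\<dots> \<le> (\<integral>\<^sup>+y\<in>{0<..}. \<phi> y \<partial>lborel)"
  proof (rule nn_integral_mono)
    fix y :: real
    show "(\<Sum>i. \<phi> (2 powr int_decode i) * indicator (?I (int_decode i)) y) \<le> \<phi> y * indicator {0<..} y"
    proof (cases "0 < y")
      case False
      have "y \<notin> ?I k" for k
      proof
        assume "y \<in> ?I k"
        then have "2 powr (k - 1) < y" by simp
        moreover have "0 < (2::real) powr (k - 1)" by simp
        ultimately show False using False by linarith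
      qed
      then show ?thesis by simp
    next
      case True
      obtain k :: int where k: "2 powr (k - 1) < y" "y \<le> 2 powr k"
        using two_powr_bracket[OF True] by blast
      have unique: "j = k" if "y \<in> ?I j" for j :: int
      proof -
        have "2 powr real_of_int (j - 1) < 2 powr real_of_int k"
          by (rule less_le_trans[OF _ k(2)]) (use that in simp)
        moreover have "2 powr real_of_int (k - 1) < 2 powr real_of_int j"
          by (rule less_le_trans[of _ y]) (use that k(1) in simp_all)
        ultimately show ?thesis by simp
      qed
      have "(\<Sum>i. \<phi> (2 powr int_decode i) * indicator (?I (int_decode i)) y)
          = (\<Sum>i\<in>{int_encode k}. \<phi> (2 powr int_decode i) * indicator (?I (int_decode i)) y)"
      proof (rule suminf_finite)
        fix i assume "i \<notin> {int_encode k}"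
        then have "int_decode i \<noteq> k" by auto
        then have "y \<notin> ?I (int_decode i)" using unique by blast
        then show "\<phi> (2 powr int_decode i) * indicator (?I (int_decode i)) y = 0" by simp
      qed simp
      also have "\<dots> \<le> \<phi> y" using anti[OF True k(2)] by (simp add: indicator_def)
      finally show ?thesis using True by simp
    qed
  qed
  finally show ?thesis .
qed

lemma ennpow_ennreal: "0 \<le> x \<Longrightarrow> ennpow (ennreal x) a = ennreal (x powr a)"
  by (simp add: ennpow_def)

lemma ennpow_mono:
  assumes "x \<le> y" "0 \<le> a"
  shows "ennpow x a \<le> ennpow y a"
proof (cases "y = \<infinity>")
  case False
  then have "x \<noteq> \<infinity>" using assms(1) by (auto simp: top_unique)
  then show ?thesis
    using False assms by (auto simp: ennpow_def intro!: ennreal_leI powr_mono2 enn2real_mono simp: less_top)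
qed (simp add: ennpow_def)

text \<open>
  Exhausting the family by finite subfamilies turns bounds that are uniform in the finite subfamily
  into a bound for the whole family, by monotone convergence.
\<close>

lemma nn_integral_family_sup_le_countable:
  assumes D: "countable D" "\<And>Q. Q \<in> D \<Longrightarrow> Q \<in> sets M" and F: "F \<in> sets M"
    and le: "\<And>S. finite S \<Longrightarrow> S \<subseteq> D \<Longrightarrow> (\<integral>\<^sup>+x\<in>F. family_sup S c x \<partial>M) \<le> B"
  shows "(\<integral>\<^sup>+x\<in>F. family_sup D c x \<partial>M) \<le> B"
proof (cases "D = {}")
  case True
  then show ?thesis using le[of "{}"] by simp
next
  case False
  define S where "S n = from_nat_into D ` {..n}" for n :: nat
  have S: "finite (S n)" "S n \<subseteq> D" for n
    using from_nat_into[OF False] by (auto simp: S_def)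
  have "family_sup D c x * indicator F x \<le> (SUP n. family_sup (S n) c x * indicator F x)" for x
  proof (cases "x \<in> F")
    case True
    have "family_sup D c x \<le> (SUP n. family_sup (S n) c x)"
    proof (rule family_sup_least)
      fix Q assume Q: "Q \<in> D" "x \<in> Q"
      then obtain n where "Q = from_nat_into D n"
        using from_nat_into_surj[OF D(1)] by metis
      then have "Q \<in> S n" by (auto simp: S_def)
      then show "c Q \<le> (SUP n. family_sup (S n) c x)"
        using family_sup_upper[of Q "S n" x c] Q by (auto intro: SUP_upper2)
    qed
    then show ?thesis using True by simp
  qed simp
  then have "(\<integral>\<^sup>+x\<in>F. family_sup D c x \<partial>M) \<le> (\<integral>\<^sup>+x. (SUP n. family_sup (S n) c x * indicator F x) \<partial>M)"
    by (rule nn_integral_mono)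
  also have "\<dots> = (SUP n. \<integral>\<^sup>+x\<in>F. family_sup (S n) c x \<partial>M)"
  proof (rule nn_integral_monotone_convergence_SUP)
    show "incseq (\<lambda>n x. family_sup (S n) c x * indicator F x)"
      unfolding family_sup_def S_def
      by (intro incseq_SucI le_funI mult_right_mono SUP_subset_mono) auto
    show "(\<lambda>x. family_sup (S n) c x * indicator F x) \<in> borel_measurable M" for n
      using S[of n] D F
      by (intro borel_measurable_times_ennreal borel_measurable_family_sup borel_measurable_indicator)
         (auto intro: countable_finite)
  qed
  also have "\<dots> \<le> B" by (rule SUP_least) (rule le[OF S])
  finally show ?thesis .
qed

section \<open>From indicators to functions\<close>

context laminar_weight
begin

text \<open>
  The second factor is the sum over \<open>k\<close> of \<open>2\<^sup>-\<^sup>k (2\<^sup>k\<^sup>+\<^sup>1)\<^sup>t\<close> with \<open>t = 1 - 1 / p\<close>, which arises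
  when the members are sorted by the relative density of a set.
\<close>

definition restricted_const :: real where
  "restricted_const = density_const * (2 powr (1 - 1 / p) / (1 - 2 powr (- (1 / p))))"

lemma two_powr_less_1: "2 powr (- (1 / p)) < (1::real)"
  using p_gt_1 by (simp add: powr_less_one)

lemma restricted_const_pos: "0 < restricted_const"
  unfolding restricted_const_def using density_const_pos two_powr_less_1 by simp

lemma density_level_le:
  assumes S: "finite S" "S \<subseteq> D" and E: "E \<in> fmeasurable N" and a: "0 < a"
  shows "measure N (\<Union>{Q \<in> S. a * measure N Q < measure N (E \<inter> Q)}) \<le> measure N E / a"
proof -
  let ?S = "{Q \<in> S. a * measure N Q < measure N (E \<inter> Q)}"
  have S': "finite ?S" "?S \<subseteq> D" using S by auto
  have "a * measure N (\<Union>?S) \<le> measure N (E \<inter> \<Union>?S)"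
    by (rule laminar_weak_type[OF S'(1) laminar_subset[OF lam S'(2)]])
       (use S' fmeas E in auto)
  also have "\<dots> \<le> measure N E"
  proof (rule measure_mono_fmeasurable)
    show "E \<inter> \<Union>?S \<in> sets N"
      using E S' fmeas by (intro sets.Int sets.finite_Union) auto
  qed (use E in auto)
  finally show ?thesis using a by (simp add: field_simps)
qed

text \<open>
  The average of \<open>\<chi>\<^sub>E\<close> with respect to \<open>N\<close> over a member \<open>Q\<close> lies in exactly one interval from
  \<open>2\<^sup>-\<^sup>k\<^sup>-\<^sup>1\<close> to \<open>2\<^sup>-\<^sup>k\<close>, unless it vanishes. So the maximal function is dominated by the sum over \<open>k\<close>
  of \<open>2\<^sup>-\<^sup>k\<close> times the maximal function of the density over those members where the average exceeds
  \<open>2\<^sup>-\<^sup>k\<^sup>-\<^sup>1\<close>. The union of these members is controlled by \<open>density_level_le\<close>.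
\<close>

lemma nn_integral_family_sup_set_finite:
  assumes S: "finite S" "S \<subseteq> D" and E: "E \<in> fmeasurable N" and F: "F \<in> fmeasurable N"
  shows "(\<integral>\<^sup>+x\<in>F. family_sup S (\<lambda>Q. ennreal (measure N (E \<inter> Q) / measure M Q)) x \<partial>M)
    \<le> ennreal (restricted_const * measure N F powr (1 / p) * measure N E powr (1 - 1 / p))"
proof -
  let ?c = "\<lambda>Q. ennreal (measure N (E \<inter> Q) / measure M Q)" and ?t = "1 - 1 / p"
  define L where "L k = {Q \<in> S. (1 / 2) ^ Suc k * measure N Q < measure N (E \<inter> Q)}" for k :: nat
  have L: "finite (L k)" "L k \<subseteq> D" for k using S by (auto simp: L_def)
  have [measurable]: "F \<in> sets M" using F by auto
  have [measurable]: "family_sup (L k) (\<lambda>Q. ennreal (avg Q)) \<in> borel_measurable M" for k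
    using L[of k] fmeas by (intro borel_measurable_family_sup) (auto intro: countable_finite)
  have pointwise: "family_sup S ?c x \<le> (\<Sum>k. ennreal ((1 / 2) ^ k) * family_sup (L k) (\<lambda>Q. ennreal (avg Q)) x)"
    (is "_ \<le> (\<Sum>k. ?h k)") for x
  proof (rule family_sup_least)
    fix Q assume Q: "Q \<in> S" "x \<in> Q"
    then have QD: "Q \<in> D" using S by blast
    let ?r = "measure N (E \<inter> Q) / measure N Q"
    show "?c Q \<le> (\<Sum>k. ?h k)"
    proof (cases "measure N (E \<inter> Q) = 0")
      case False
      have "measure N (E \<inter> Q) \<le> measure N Q"
        by (rule measure_mono_fmeasurable) (use E fmeas[OF QD] in auto)
      then have "0 < ?r" "?r \<le> 1"
        using False pos[OF QD] by (auto simp: zero_less_measure_iff)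
      then obtain k where k: "(1 / 2) ^ Suc k < ?r" "?r \<le> (1 / 2) ^ k"
        by (rule half_power_bracket)
      have "Q \<in> L k" using k(1) Q pos[OF QD] by (auto simp: L_def field_simps)
      have "?c Q = ennreal (?r * avg Q)" using pos[OF QD] by (simp add: avg_def)
      also have "\<dots> \<le> ennreal ((1 / 2) ^ k * avg Q)"
        using k(2) avg_pos[OF QD] by (intro ennreal_leI mult_right_mono) auto
      also have "\<dots> = ennreal ((1 / 2) ^ k) * ennreal (avg Q)"
        using avg_pos[OF QD] by (simp add: ennreal_mult)
      also have "\<dots> \<le> ?h k"
        by (intro mult_left_mono family_sup_upper) (use \<open>Q \<in> L k\<close> Q in auto)
      also have "\<dots> \<le> (\<Sum>k. ?h k)" by (rule term_le_suminf_ennreal)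
      finally show ?thesis .
    qed simp
  qed
  let ?f = "measure N F powr (1 / p)" and ?e = "measure N E powr ?t"
  let ?g = "2 powr (- (1 / p)) :: real"
  have layer: "(\<integral>\<^sup>+x\<in>F. family_sup (L k) (\<lambda>Q. ennreal (avg Q)) x \<partial>M)
      \<le> ennreal (density_const * ?f * (2 ^ Suc k * measure N E) powr ?t)" for k
  proof -
    have "measure N (\<Union>(L k)) \<le> 2 ^ Suc k * measure N E"
      using density_level_le[OF S E, of "(1 / 2) ^ Suc k"] by (simp add: L_def power_one_over field_simps)
    then have "density_const * ?f * measure N (\<Union>(L k)) powr ?t \<le> density_const * ?f * (2 ^ Suc k * measure N E) powr ?t"
      using p_gt_1 density_const_pos by (intro mult_left_mono powr_mono2) auto
    then show ?thesis
      using nn_integral_family_sup_density[OF L F] by (meson ennreal_leI order_trans)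
  qed
  have "(\<integral>\<^sup>+x\<in>F. family_sup S ?c x \<partial>M)
      \<le> (\<integral>\<^sup>+x. (\<Sum>k. ennreal ((1 / 2) ^ k) * (family_sup (L k) (\<lambda>Q. ennreal (avg Q)) x * indicator F x)) \<partial>M)"
  proof (rule nn_integral_mono)
    fix x
    show "family_sup S ?c x * indicator F x
      \<le> (\<Sum>k. ennreal ((1 / 2) ^ k) * (family_sup (L k) (\<lambda>Q. ennreal (avg Q)) x * indicator F x))"
      using pointwise[of x] by (cases "x \<in> F") auto
  qed
  also have "\<dots> = (\<Sum>k. ennreal ((1 / 2) ^ k) * (\<integral>\<^sup>+x\<in>F. family_sup (L k) (\<lambda>Q. ennreal (avg Q)) x \<partial>M))"
    by (simp add: nn_integral_suminf nn_integral_cmult)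
  also have "\<dots> \<le> (\<Sum>k. ennreal ((1 / 2) ^ k) * ennreal (density_const * ?f * (2 ^ Suc k * measure N E) powr ?t))"
    by (intro suminf_le mult_left_mono layer) auto
  also have "\<dots> = (\<Sum>k. ennreal (density_const * 2 powr ?t * ?f * ?e * ?g ^ k))"
  proof (intro suminf_cong)
    fix k :: nat
    have "(1 / 2) ^ k * (2 ^ Suc k) powr ?t = 2 powr ?t * ?g ^ k"
    proof -
      have "(1 / 2) ^ k * (2 ^ Suc k) powr ?t = (2::real) powr (- real k) * 2 powr (real (Suc k) * ?t)"
      proof -
        have "(2::real) ^ Suc k = 2 powr real (Suc k)" by (rule powr_realpow[symmetric]) simp
        moreover have "(1 / 2 :: real) ^ k = 2 powr (- real k)"
          by (simp add: powr_minus_divide powr_realpow power_one_over)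
        ultimately show ?thesis by (simp only: powr_powr)
      qed
      also have "\<dots> = 2 powr ?t * 2 powr (real k * - (1 / p))"
        by (simp add: algebra_simps flip: powr_add)
      also have "2 powr (real k * - (1 / p)) = ?g ^ k"
        by (simp add: powr_realpow[symmetric] powr_powr mult.commute)
      finally show ?thesis .
    qed
    then have "(1 / 2) ^ k * (density_const * ?f * (2 ^ Suc k * measure N E) powr ?t) = density_const * 2 powr ?t * ?f * ?e * ?g ^ k"
      by (simp add: powr_mult ac_simps)
    then show "ennreal ((1 / 2) ^ k) * ennreal (density_const * ?f * (2 ^ Suc k * measure N E) powr ?t)
        = ennreal (density_const * 2 powr ?t * ?f * ?e * ?g ^ k)"
      using density_const_pos by (simp flip: ennreal_mult)
  qed
  also have "\<dots> = ennreal (density_const * 2 powr ?t * ?f * ?e * (1 / (1 - ?g)))"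
    using two_powr_less_1 density_const_pos
    by (intro suminf_ennreal_eq sums_mult geometric_sums) auto
  also have "density_const * 2 powr ?t * ?f * ?e * (1 / (1 - ?g)) = restricted_const * ?f * ?e"
    by (simp add: restricted_const_def)
  finally show ?thesis .
qed

text \<open>
  Intersecting \<open>E\<close> with the union of a finite subfamily does not change the coefficients and makes it
  a set of finite measure, so the bound survives for sets of infinite measure.
\<close>

lemma nn_integral_family_sup_set:
  assumes D: "countable D" and E: "E \<in> sets M" and F: "F \<in> fmeasurable N"
  shows "(\<integral>\<^sup>+x\<in>F. family_sup D (\<lambda>Q. emeasure N (E \<inter> Q) / emeasure M Q) x \<partial>M)
    \<le> ennreal (restricted_const * measure N F powr (1 / p)) * ennpow (emeasure N E) (1 - 1 / p)"
proof (rule nn_integral_family_sup_le_countable[OF D])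
  show "Q \<in> sets M" if "Q \<in> D" for Q using fmeas(1)[OF that] by auto
  show "F \<in> sets M" using F by auto
  fix S assume S: "finite S" "S \<subseteq> D"
  let ?E = "E \<inter> \<Union>S"
  have "\<Union>S \<in> fmeasurable N" using S fmeas(2) fmeasurable.finite_Union[of S N] by blast
  then have fE: "?E \<in> fmeasurable N"
    using E fmeasurable_Int_fmeasurable[of "\<Union>S" N E] by (simp add: Int_commute)
  have "family_sup S (\<lambda>Q. emeasure N (E \<inter> Q) / emeasure M Q) x
      = family_sup S (\<lambda>Q. ennreal (measure N (?E \<inter> Q) / measure M Q)) x" for x
    unfolding family_sup_def
  proof (intro SUP_cong refl arg_cong2[of _ _ _ _ "(*)"])
    fix Q assume Q: "Q \<in> S"
    then have QD: "Q \<in> D" and *: "E \<inter> Q = ?E \<inter> Q" using S by auto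
    have "?E \<inter> Q \<in> fmeasurable N" by (rule fmeasurable.Int[OF fE fmeas(2)[OF QD]])
    then show "emeasure N (E \<inter> Q) / emeasure M Q = ennreal (measure N (?E \<inter> Q) / measure M Q)"
      unfolding * using fmeas(1)[OF QD] pos(1)[OF QD]
      by (simp add: emeasure_eq_measure2 divide_ennreal)
  qed
  then have "(\<integral>\<^sup>+x\<in>F. family_sup S (\<lambda>Q. emeasure N (E \<inter> Q) / emeasure M Q) x \<partial>M)
      \<le> ennreal (restricted_const * measure N F powr (1 / p) * measure N ?E powr (1 - 1 / p))"
    using nn_integral_family_sup_set_finite[OF S fE F] by simp
  also have "\<dots> = ennreal (restricted_const * measure N F powr (1 / p)) * ennpow (emeasure N ?E) (1 - 1 / p)"
    using fE restricted_const_pos by (simp add: emeasure_eq_measure2 ennpow_ennreal ennreal_mult)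
  also have "\<dots> \<le> ennreal (restricted_const * measure N F powr (1 / p)) * ennpow (emeasure N E) (1 - 1 / p)"
    using p_gt_1 E by (intro mult_left_mono ennpow_mono emeasure_mono) auto
  finally show "(\<integral>\<^sup>+x\<in>F. family_sup S (\<lambda>Q. emeasure N (E \<inter> Q) / emeasure M Q) x \<partial>M)
      \<le> ennreal (restricted_const * measure N F powr (1 / p)) * ennpow (emeasure N E) (1 - 1 / p)" .
qed

text \<open>
  Dominate \<open>h\<close> by the sum of \<open>2\<^sup>k\<^sup>+\<^sup>1 \<chi>{h > 2\<^sup>k}\<close> over all integers \<open>k\<close> and apply the bound for
  indicators to each term; the sum of the bounds is compared with the integral by
  \<open>dyadic_sum_le_nn_integral\<close>. The integral on the right is, up to the factor \<open>q\<close>, the \<open>L\<^sup>q\<^sup>,\<^sup>1\<close>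
  norm of the positive part of \<open>h\<close>.
\<close>

lemma nn_integral_family_sup_function:
  fixes h :: "'a \<Rightarrow> real"
  assumes D: "countable D" and h[measurable]: "h \<in> borel_measurable M" and F: "F \<in> fmeasurable N"
  shows "(\<integral>\<^sup>+x\<in>F. family_sup D (\<lambda>Q. (\<integral>\<^sup>+y\<in>Q. ennreal (h y) \<partial>N) / emeasure M Q) x \<partial>M)
    \<le> ennreal (4 * restricted_const * measure N F powr (1 / p))
      * (\<integral>\<^sup>+y\<in>{0<..}. ennpow (emeasure N {x \<in> space M. y < h x}) (1 - 1 / p) \<partial>lborel)"
proof -
  let ?t = "1 - 1 / p"
  let ?l = "\<lambda>y. emeasure N {x \<in> space M. y < h x}"
  define H where "H i = {x \<in> space M. 2 powr int_decode i < h x}" for i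
  define a where "a i = ennreal (2 powr (int_decode i + 1))" for i
  have [measurable]: "H i \<in> sets M" "H i \<in> sets N" for i by (simp_all add: H_def)
  have [measurable]: "F \<in> sets M" using F by auto
  have Dsets: "Q \<in> sets M" if "Q \<in> D" for Q using fmeas(1)[OF that] by auto
  let ?c = "\<lambda>E Q. emeasure N (E \<inter> Q) / emeasure M Q"
  have [measurable]: "family_sup D (?c E) \<in> borel_measurable M" for E
    by (rule borel_measurable_family_sup[OF D Dsets])
  have layers: "ennreal (h x) \<le> (\<Sum>i. a i * indicator (H i) x)" if "x \<in> space M" for x
  proof (cases "0 < h x")
    case True
    then obtain k :: int where k: "2 powr (k - 1) < h x" "h x \<le> 2 powr k"
      by (rule two_powr_bracket)
    have "ennreal (h x) \<le> a (int_encode (k - 1)) * indicator (H (int_encode (k - 1))) x"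
      using k that by (auto simp: a_def H_def indicator_def intro!: ennreal_leI)
    also have "\<dots> \<le> (\<Sum>i. a i * indicator (H i) x)" by (rule term_le_suminf_ennreal)
    finally show ?thesis .
  qed (simp add: ennreal_neg)
  have coeff: "(\<integral>\<^sup>+y\<in>Q. ennreal (h y) \<partial>N) / emeasure M Q \<le> (\<Sum>i. a i * ?c (H i) Q)" if "Q \<in> D" for Q
  proof -
    have [measurable]: "Q \<in> sets N" using Dsets[OF that] by simp
    have "(\<integral>\<^sup>+y\<in>Q. ennreal (h y) \<partial>N) \<le> (\<integral>\<^sup>+y. (\<Sum>i. a i * indicator (H i \<inter> Q) y) \<partial>N)"
    proof (rule nn_integral_mono)
      fix y assume "y \<in> space N"
      then have "y \<in> space M" using sets_eq_imp_space_eq[OF sets_eq] by simp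
      then show "ennreal (h y) * indicator Q y \<le> (\<Sum>i. a i * indicator (H i \<inter> Q) y)"
        using layers[of y] by (cases "y \<in> Q") (auto simp: indicator_inter_arith)
    qed
    also have "\<dots> = (\<Sum>i. a i * emeasure N (H i \<inter> Q))"
      using sets.Int[OF \<open>H _ \<in> sets N\<close> \<open>Q \<in> sets N\<close>]
      by (simp add: nn_integral_suminf nn_integral_cmult_indicator)
    finally have "(\<integral>\<^sup>+y\<in>Q. ennreal (h y) \<partial>N) / emeasure M Q \<le> (\<Sum>i. a i * emeasure N (H i \<inter> Q)) / emeasure M Q"
      by (rule divide_right_mono_ennreal)
    also have "\<dots> = (\<Sum>i. a i * ?c (H i) Q)"
      by (simp add: divide_ennreal_def mult.assoc flip: ennreal_suminf_multc)
    finally show ?thesis .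
  qed
  have pointwise: "family_sup D (\<lambda>Q. (\<integral>\<^sup>+y\<in>Q. ennreal (h y) \<partial>N) / emeasure M Q) x
      \<le> (\<Sum>i. a i * family_sup D (?c (H i)) x)" for x
  proof (rule family_sup_least)
    fix Q assume Q: "Q \<in> D" "x \<in> Q"
    have "(\<integral>\<^sup>+y\<in>Q. ennreal (h y) \<partial>N) / emeasure M Q \<le> (\<Sum>i. a i * ?c (H i) Q)"
      by (rule coeff[OF Q(1)])
    also have "\<dots> \<le> (\<Sum>i. a i * family_sup D (?c (H i)) x)"
      by (intro suminf_le mult_left_mono family_sup_upper[OF Q, of "?c (H _)"]) auto
    finally show "(\<integral>\<^sup>+y\<in>Q. ennreal (h y) \<partial>N) / emeasure M Q \<le> (\<Sum>i. a i * family_sup D (?c (H i)) x)" .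
  qed
  let ?C = "ennreal (restricted_const * measure N F powr (1 / p))"
  have "(\<integral>\<^sup>+x\<in>F. family_sup D (\<lambda>Q. (\<integral>\<^sup>+y\<in>Q. ennreal (h y) \<partial>N) / emeasure M Q) x \<partial>M)
      \<le> (\<integral>\<^sup>+x. (\<Sum>i. a i * (family_sup D (?c (H i)) x * indicator F x)) \<partial>M)"
  proof (rule nn_integral_mono)
    fix x
    show "family_sup D (\<lambda>Q. (\<integral>\<^sup>+y\<in>Q. ennreal (h y) \<partial>N) / emeasure M Q) x * indicator F x
      \<le> (\<Sum>i. a i * (family_sup D (?c (H i)) x * indicator F x))"
      using pointwise[of x] by (cases "x \<in> F") auto
  qed
  also have "\<dots> = (\<Sum>i. a i * (\<integral>\<^sup>+x\<in>F. family_sup D (?c (H i)) x \<partial>M))"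
    by (simp add: nn_integral_suminf nn_integral_cmult)
  also have "\<dots> \<le> (\<Sum>i. a i * (?C * ennpow (emeasure N (H i)) ?t))"
    by (intro suminf_le mult_left_mono nn_integral_family_sup_set D F) auto
  also have "\<dots> = (\<Sum>i. ennreal (4 * restricted_const * measure N F powr (1 / p))
      * (ennreal (2 powr (int_decode i - 1)) * ennpow (?l (2 powr int_decode i)) ?t))"
  proof (intro suminf_cong)
    fix i
    have "2 powr (int_decode i + 1) * (restricted_const * measure N F powr (1 / p))
        = 4 * restricted_const * measure N F powr (1 / p) * 2 powr (int_decode i - 1)"
      by (simp add: powr_add powr_diff)
    then have "a i * ?C = ennreal (4 * restricted_const * measure N F powr (1 / p)) * ennreal (2 powr (int_decode i - 1))"
      unfolding a_def using restricted_const_pos by (simp flip: ennreal_mult)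
    then show "a i * (?C * ennpow (emeasure N (H i)) ?t) = ennreal (4 * restricted_const * measure N F powr (1 / p))
      * (ennreal (2 powr (int_decode i - 1)) * ennpow (?l (2 powr int_decode i)) ?t)"
      by (simp add: mult.assoc[symmetric] H_def)
  qed
  also have "\<dots> = ennreal (4 * restricted_const * measure N F powr (1 / p))
      * (\<Sum>i. ennreal (2 powr (int_decode i - 1)) * ennpow (?l (2 powr int_decode i)) ?t)"
    by (rule ennreal_suminf_cmult)
  also have "\<dots> \<le> ennreal (4 * restricted_const * measure N F powr (1 / p))
      * (\<integral>\<^sup>+y\<in>{0<..}. ennpow (?l y) ?t \<partial>lborel)"
    using p_gt_1
    by (intro mult_left_mono dyadic_sum_le_nn_integral ennpow_mono emeasure_mono) auto
  finally show ?thesis .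
qed

end

section \<open>Shifted dyadic grids\<close>

text \<open>
  The one third trick: besides the usual dyadic grid on the line, consider the one whose points of
  scale \<open>2\<^sup>k\<close> are translated by a third of the scale. The sign alternates with \<open>k\<close> because
  \<open>2 * (1 / 3)\<close> and \<open>- 1 / 3\<close> differ by an integer, so that coarse grid points are fine ones and the
  translated intervals are nested as well.
\<close>

definition grid_shift :: "bool \<Rightarrow> int \<Rightarrow> real" where
  "grid_shift b k = (if b then if even k then 1 / 3 else - 1 / 3 else 0)"

definition grid_index :: "bool \<Rightarrow> int \<Rightarrow> real \<Rightarrow> int" where
  "grid_index b k y = \<lfloor>y / 2 powr k - grid_shift b k\<rfloor>"

lemma grid_index_Suc:
  "grid_index b (k + 1) y = (grid_index b k y + (if b then if even k then 1 else - 1 else 0)) div 2"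
proof -
  define s :: int where "s = (if b then if even k then 1 else - 1 else 0)"
  define z where "z = y / 2 powr (k + 1) - grid_shift b (k + 1)"
  have "y / 2 powr k - grid_shift b k = 2 * z - real_of_int s"
    by (simp add: z_def s_def grid_shift_def powr_add field_simps)
  then have "grid_index b k y + s = \<lfloor>2 * z\<rfloor>"
    unfolding grid_index_def by simp
  moreover have "\<lfloor>2 * z / real_of_int 2\<rfloor> = \<lfloor>2 * z\<rfloor> div 2"
    by (rule floor_divide_real_eq_div) simp
  moreover have "grid_index b (k + 1) y = \<lfloor>z\<rfloor>" by (simp add: grid_index_def z_def)
  ultimately show ?thesis by (simp add: s_def)
qed

lemma grid_index_coarser:
  assumes "j \<le> k" "grid_index b j x = grid_index b j y"
  shows "grid_index b k x = grid_index b k y"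
  using assms by (induction k rule: int_ge_induct) (auto simp: grid_index_Suc)

lemma grid_index_eq_iff:
  "grid_index b k y = m \<longleftrightarrow> 2 powr k * (m + grid_shift b k) \<le> y \<and> y < 2 powr k * (m + grid_shift b k) + 2 powr k"
  unfolding grid_index_def floor_eq_iff by (auto simp: field_simps)

lemma grid_index_mono: "x \<le> y \<Longrightarrow> grid_index b k x \<le> grid_index b k y"
  unfolding grid_index_def by (intro floor_mono diff_right_mono divide_right_mono) auto

text \<open>
  A half-open interval of scale \<open>2\<^sup>k\<close> fails to contain \<open>[a, a + l]\<close> only if a grid point separates
  the end points. Points of the two grids are at least \<open>2\<^sup>k / 3\<close> apart, so this cannot happen in
  both grids.
\<close>

lemma grid_index_interval:
  assumes "0 < l" "3 * l \<le> 2 powr k"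
  shows "\<exists>b. grid_index b k (a + l) = grid_index b k a"
proof (rule ccontr)
  assume "\<not> ?thesis"
  then have ne: "grid_index b k (a + l) \<noteq> grid_index b k a" for b by blast
  define x d where "x = a / 2 powr k" and "d = l / 2 powr k"
  have d: "0 < d" "d \<le> 1 / 3" using assms by (auto simp: d_def field_simps)
  define m where "m b = grid_index b k (a + l)" for b
  have idx: "m b = \<lfloor>x + d - grid_shift b k\<rfloor>" "grid_index b k a = \<lfloor>x - grid_shift b k\<rfloor>" for b
    by (simp_all add: m_def grid_index_def x_def d_def add_divide_distrib)
  have bounds: "x - grid_shift b k < m b" "m b \<le> x + d - grid_shift b k" for b
  proof -
    have "grid_index b k a \<le> m b" unfolding idx using d by (intro floor_mono) simp
    then have "\<lfloor>x - grid_shift b k\<rfloor> < m b" using ne[of b] idx(2)[of b] by (simp add: m_def)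
    then show "x - grid_shift b k < m b" by (simp add: floor_less_iff)
    show "m b \<le> x + d - grid_shift b k" unfolding idx by simp
  qed
  have "real_of_int (m False - m True) - grid_shift True k < d"
    "- d < real_of_int (m False - m True) - grid_shift True k"
    using bounds[of True] bounds[of False] by (auto simp: grid_shift_def)
  then have "real_of_int (m False - m True) < real_of_int 1 \<and> real_of_int 0 < real_of_int (m False - m True)
      \<or> real_of_int (m False - m True) < real_of_int 0 \<and> real_of_int (- 1) < real_of_int (m False - m True)"
    using d by (auto simp: grid_shift_def split: if_splits)
  then show False unfolding of_int_less_iff by presburger
qed

text \<open>
  The set \<open>B\<close> consists of the coordinates in which the translated grid is used.
\<close>

definition grid_cell :: "'n set \<Rightarrow> int \<Rightarrow> ('n::finite \<Rightarrow> int) \<Rightarrow> (real ^ 'n) set" where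
  "grid_cell B k m = {y. \<forall>i. grid_index (i \<in> B) k (y $ i) = m i}"

definition grid :: "'n set \<Rightarrow> (real ^ 'n::finite) set set" where
  "grid B = {grid_cell B k m | k m. True}"

lemma countable_grid: "countable (grid B)"
proof -
  have "grid B = (\<lambda>(k, m). grid_cell B k m) ` UNIV" by (auto simp: grid_def)
  then show ?thesis by simp
qed

lemma laminar_grid: "laminar (grid B)"
proof -
  have nested: "grid_cell B k m \<subseteq> grid_cell B k' m'"
    if "k \<le> k'" "x \<in> grid_cell B k m" "x \<in> grid_cell B k' m'" for k k' m m' x
  proof
    fix y assume "y \<in> grid_cell B k m"
    then have "grid_index (i \<in> B) k (y $ i) = grid_index (i \<in> B) k (x $ i)" for i
      using that(2) by (simp add: grid_cell_def)
    then have "grid_index (i \<in> B) k' (y $ i) = grid_index (i \<in> B) k' (x $ i)" for i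
      by (rule grid_index_coarser[OF that(1)])
    then show "y \<in> grid_cell B k' m'" using that(3) by (simp add: grid_cell_def)
  qed
  show ?thesis
    unfolding laminar_def
  proof (intro ballI)
    fix P Q assume "P \<in> grid B" "Q \<in> grid B"
    then obtain k m k' m' where PQ: "P = grid_cell B k m" "Q = grid_cell B k' m'"
      by (auto simp: grid_def)
    show "P \<inter> Q = {} \<or> P \<subseteq> Q \<or> Q \<subseteq> P"
      unfolding PQ using nested[of k k' _ m m'] nested[of k' k _ m' m] by (metis disjoint_iff linear)
  qed
qed

lemma measure_lebesgue_cube:
  fixes a :: "real ^ 'n::finite"
  assumes "0 \<le> l"
  shows "measure lebesgue (cbox a (\<chi> i. a $ i + l)) = l ^ CARD('n)"
proof -
  have "cbox a (\<chi> i. a $ i + l) \<noteq> {}" using assms by (simp add: interval_ne_empty_cart)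
  then show ?thesis by (simp add: content_cbox_cart)
qed

lemma cbox_in_cubes: "0 < l \<Longrightarrow> cbox a (\<chi> i. a $ i + l) \<in> cubes"
  unfolding cubes_def by blast

lemma cubes_lmeasurable: "Q \<in> cubes \<Longrightarrow> Q \<in> lmeasurable"
  by (auto simp: cubes_def)

lemma cubes_measure_pos: "Q \<in> cubes \<Longrightarrow> 0 < measure lebesgue Q"
  by (auto simp: cubes_def simp del: measure_completion simp: measure_lebesgue_cube)

lemma grid_cell_cube:
  fixes m :: "'n::finite \<Rightarrow> int"
  obtains a :: "real ^ 'n" where "grid_cell B k m \<subseteq> cbox a (\<chi> i. a $ i + 2 powr k)"
    "grid_cell B k m \<in> lmeasurable"
    "measure lebesgue (grid_cell B k m) = measure lebesgue (cbox a (\<chi> i. a $ i + 2 powr k))"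
proof
  let ?a = "\<chi> i. 2 powr k * (m i + grid_shift (i \<in> B) k) :: real ^ 'n"
  let ?b = "\<chi> i. ?a $ i + 2 powr k"
  have eq: "grid_cell B k m = {y. \<forall>i. ?a $ i \<le> y $ i \<and> y $ i < ?a $ i + 2 powr k}"
    by (simp add: grid_cell_def grid_index_eq_iff)
  show sub: "grid_cell B k m \<subseteq> cbox ?a ?b"
    unfolding eq by (auto simp: mem_box_cart less_imp_le)
  have sub': "box ?a ?b \<subseteq> grid_cell B k m"
    unfolding eq by (auto simp: mem_box_cart less_imp_le)
  have "?a \<in> cbox ?a ?b" by (simp add: mem_box_cart)
  then have box_eq: "measure lebesgue (box ?a ?b) = measure lebesgue (cbox ?a ?b)"
    by (simp add: measure_lborel_box_eq measure_lborel_cbox_eq)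
  have "grid_cell B k m = (\<Inter>i\<in>UNIV. {y. ?a $ i \<le> y $ i} \<inter> {y. y $ i < ?a $ i + 2 powr k})"
    unfolding eq by blast
  also have "\<dots> \<in> sets lebesgue"
    by (intro sets.finite_INT sets.Int)
       (auto intro!: borel_closed borel_open closed_Collect_le open_Collect_less continuous_intros)
  finally have "grid_cell B k m \<in> sets lebesgue" .
  then show meas: "grid_cell B k m \<in> lmeasurable"
    by (rule fmeasurableI2[OF lmeasurable_cbox sub])
  have "measure lebesgue (grid_cell B k m) \<le> measure lebesgue (cbox ?a ?b)"
    by (rule measure_mono_fmeasurable[OF sub]) (use meas in auto)
  moreover have "measure lebesgue (box ?a ?b) \<le> measure lebesgue (grid_cell B k m)"
    by (rule measure_mono_fmeasurable[OF sub']) (use meas in auto)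
  ultimately show "measure lebesgue (grid_cell B k m) = measure lebesgue (cbox ?a ?b)"
    using box_eq by linarith
qed

text \<open>
  The choice between the two grids is made for each coordinate separately. If \<open>l\<close> is the side of the
  cube, the scale is the power of 2 with \<open>3 l \<le> 2\<^sup>k < 6 l\<close>, which gives the constant \<open>6\<^sup>n\<close>.
\<close>

lemma cube_in_grid_cell:
  fixes P :: "(real ^ 'n::finite) set"
  assumes "P \<in> cubes"
  obtains B Q where "Q \<in> grid B" "P \<subseteq> Q" "measure lebesgue Q \<le> 6 ^ CARD('n) * measure lebesgue P"
proof -
  obtain a :: "real ^ 'n" and l where P: "P = cbox a (\<chi> i. a $ i + l)" "0 < l"
    using assms by (auto simp: cubes_def)
  have "0 < 3 * l" using P(2) by simp
  then obtain k :: int where k: "2 powr (k - 1) < 3 * l" "3 * l \<le> 2 powr k"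
    by (rule two_powr_bracket)
  have "2 powr real_of_int k = 2 * 2 powr real_of_int (k - 1)" by (simp add: powr_diff)
  then have scale: "2 powr k \<le> 6 * l" using k(1) by linarith
  define B where "B = {i. grid_index True k (a $ i + l) = grid_index True k (a $ i)}"
  define m where "m i = grid_index (i \<in> B) k (a $ i)" for i
  have ends: "grid_index (i \<in> B) k (a $ i + l) = m i" for i
  proof (cases "i \<in> B")
    case True
    then show ?thesis by (simp add: m_def B_def)
  next
    case False
    obtain b where b: "grid_index b k (a $ i + l) = grid_index b k (a $ i)"
      using grid_index_interval[OF P(2) k(2)] by blast
    then have "\<not> b" using False by (cases b) (auto simp: B_def)
    then show ?thesis using b False by (simp add: m_def)
  qed
  have "P \<subseteq> grid_cell B k m"
  proof
    fix y assume "y \<in> P"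
    then have y: "a $ i \<le> y $ i" "y $ i \<le> a $ i + l" for i
      by (auto simp: P mem_box_cart)
    have "grid_index (i \<in> B) k (y $ i) = m i" for i
      using ends[of i] grid_index_mono[OF y(1)[of i], of "i \<in> B" k]
        grid_index_mono[OF y(2)[of i], of "i \<in> B" k] unfolding m_def by linarith
    then show "y \<in> grid_cell B k m" by (simp add: grid_cell_def)
  qed
  moreover have "measure lebesgue (grid_cell B k m) \<le> 6 ^ CARD('n) * measure lebesgue P"
  proof -
    obtain c :: "real ^ 'n" where
      "measure lebesgue (grid_cell B k m) = measure lebesgue (cbox c (\<chi> i. c $ i + 2 powr k))"
      using grid_cell_cube by blast
    also have "\<dots> = (2 powr k) ^ CARD('n)" by (rule measure_lebesgue_cube) simp
    also have "\<dots> \<le> (6 * l) ^ CARD('n)"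
      using scale by (intro power_mono) auto
    also have "\<dots> = 6 ^ CARD('n) * measure lebesgue P"
      using P measure_lebesgue_cube[of l a] by (simp add: power_mult_distrib)
    finally show ?thesis .
  qed
  ultimately show ?thesis using that[of "grid_cell B k m" B] by (auto simp: grid_def)
qed

section \<open>Weights and the restricted inequality\<close>

lemma sets_weight_measure [simp]: "sets (weight_measure w) = sets lebesgue"
  by (simp add: weight_measure_def)

lemma space_weight_measure [simp]: "space (weight_measure w) = UNIV"
  by (simp add: weight_measure_def)

lemma weight_measurable: "weight w \<Longrightarrow> w \<in> borel_measurable lebesgue"
  and weight_pos: "weight w \<Longrightarrow> 0 < w x"
  by (auto simp: weight_def)

lemma nn_integral_weight_measure:
  assumes "weight w" "g \<in> borel_measurable lebesgue"
  shows "(\<integral>\<^sup>+x. g x \<partial>weight_measure w) = (\<integral>\<^sup>+x. ennreal (w x) * g x \<partial>lebesgue)"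
  unfolding weight_measure_def
  using weight_measurable[OF assms(1)] assms(2) by (intro nn_integral_density) auto

lemma emeasure_weight_measure:
  assumes "weight w" "E \<in> sets lebesgue"
  shows "emeasure (weight_measure w) E = (\<integral>\<^sup>+x\<in>E. ennreal (w x) \<partial>lebesgue)"
  unfolding weight_measure_def
  using weight_measurable[OF assms(1)] assms(2) by (intro emeasure_density) auto

lemma weight_fmeasurable_compact:
  assumes "weight w" "compact S"
  shows "S \<in> fmeasurable (weight_measure w)"
proof (rule fmeasurableI)
  have S: "S \<in> sets lebesgue" using assms(2) by (simp add: lmeasurable_compact fmeasurableD)
  then show "S \<in> sets (weight_measure w)" by simp
  have "integrable lebesgue (\<lambda>x. indicator S x *\<^sub>R w x)"
    using assms unfolding weight_def set_integrable_def[symmetric] by blast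
  then have "(\<integral>\<^sup>+x. ennreal (norm (indicator S x *\<^sub>R w x)) \<partial>lebesgue) < \<infinity>"
    unfolding integrable_iff_bounded by simp
  moreover have "ennreal (norm (indicator S x *\<^sub>R w x)) = ennreal (w x) * indicator S x" for x
    using weight_pos[OF assms(1), of x] by (simp add: indicator_def)
  ultimately show "emeasure (weight_measure w) S < \<infinity>"
    by (simp add: emeasure_weight_measure[OF assms(1) S])
qed

lemma weight_fmeasurable_cube: "weight w \<Longrightarrow> Q \<in> cubes \<Longrightarrow> Q \<in> fmeasurable (weight_measure w)"
  by (auto simp: cubes_def intro!: weight_fmeasurable_compact)

lemma weight_fmeasurable_bounded:
  assumes "weight w" "S \<in> sets lebesgue" "bounded S"
  shows "S \<in> fmeasurable (weight_measure w)"
proof -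
  obtain a b where "S \<subseteq> cbox a b" using bounded_subset_cbox_symmetric[OF assms(3)] by blast
  then show ?thesis
    by (rule fmeasurableI2[OF weight_fmeasurable_compact[OF assms(1) compact_cbox]]) (use assms(2) in simp)
qed

lemma weight_measure_eq_0D:
  assumes "weight w" "E \<in> sets lebesgue" "emeasure (weight_measure w) E = 0"
  shows "emeasure lebesgue E = 0"
proof -
  have "E \<in> null_sets (density lebesgue (\<lambda>x. ennreal (w x)))"
    using assms by (auto simp: weight_measure_def null_sets_def)
  then have "AE x in lebesgue. x \<in> E \<longrightarrow> ennreal (w x) = 0"
    using weight_measurable[OF assms(1)] by (subst (asm) null_sets_density_iff) auto
  then have "AE x in lebesgue. x \<notin> E"
    by eventually_elim (use weight_pos[OF assms(1)] in \<open>auto simp: ennreal_eq_0_iff not_le[symmetric]\<close>)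
  then show ?thesis using assms(2) by (simp add: AE_iff_null_sets[symmetric] null_setsD1)
qed

lemma emeasure_lebesgue_eq_weight_integral:
  assumes "weight w" "E \<in> sets lebesgue"
  shows "emeasure lebesgue E = (\<integral>\<^sup>+x\<in>E. ennreal (inverse (w x)) \<partial>weight_measure w)"
proof -
  note [measurable] = weight_measurable[OF assms(1)] assms(2)
  have *: "ennreal (w x) * (ennreal (inverse (w x)) * indicator E x) = indicator E x" for x
    using weight_pos[OF assms(1), of x] by (simp add: mult.assoc[symmetric] flip: ennreal_mult)
  show ?thesis
    by (subst nn_integral_weight_measure[OF assms(1)]) (auto simp: *)
qed

text \<open>
  The fraction is the sum over \<open>k\<close> of \<open>2\<^sup>k\<^sup>+\<^sup>1 2\<^sup>-\<^sup>k\<^sup>q\<close>, the contribution of the dyadic layers of a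
  function above a suitable height; the 1 accounts for its values below this height.
\<close>

definition kolmogorov_const :: "real \<Rightarrow> real" where
  "kolmogorov_const q = 1 + 2 / (1 - 2 powr (1 - q))"

lemma kolmogorov_const_pos: "1 < q \<Longrightarrow> 0 < kolmogorov_const q"
  unfolding kolmogorov_const_def using powr_less_one[of 2 "1 - q"] by (simp add: add_pos_pos)

text \<open>
  Kolmogorov's inequality: on a set of finite measure the weak \<open>L\<^sup>q\<close> norm controls the integral. The
  level \<open>s\<close> below is the one at which the weak bound for the measure of a level set equals the measure
  of \<open>E\<close>; lower values of \<open>g\<close> are bounded by \<open>s\<close>, and the values above \<open>s\<close> are decomposed
  at the heights \<open>2\<^sup>k s\<close>.
\<close>

lemma nn_integral_le_weak_Lq:
  fixes g :: "'a \<Rightarrow> real" and q W :: real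
  assumes q: "1 < q" and W: "0 < W" and g[measurable]: "g \<in> borel_measurable N"
    and E: "E \<in> fmeasurable N"
    and weak: "\<And>y. 0 < y \<Longrightarrow> measure N {x \<in> E. y < g x} \<le> (W / y) powr q"
  shows "(\<integral>\<^sup>+x\<in>E. ennreal (g x) \<partial>N)
    \<le> ennreal (kolmogorov_const q * W * measure N E powr (1 - 1 / q))"
proof (cases "measure N E = 0")
  case True
  then have "emeasure N E = 0" using E by (simp add: emeasure_eq_measure2)
  then have "(\<integral>\<^sup>+x\<in>E. ennreal (g x) \<partial>N) = 0"
    using E by (intro nn_integral_null_set null_setsI) auto
  then show ?thesis by simp
next
  case False
  let ?e = "measure N E" and ?r = "2 powr (1 - q) :: real"
  have e: "0 < ?e" using False by (simp add: zero_less_measure_iff)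
  have r: "0 < ?r" "?r < 1" using q by (auto simp: powr_less_one)
  define s where "s = W / ?e powr (1 / q)"
  have s: "0 < s" using W e by (simp add: s_def)
  have Ws: "(W / s) powr q = ?e"
    using W e q by (simp add: s_def powr_powr)
  have se: "s * ?e = W * ?e powr (1 - 1 / q)"
    using e by (simp add: s_def powr_diff)
  define H where "H k = {x \<in> E. s * 2 ^ k < g x}" for k :: nat
  have [measurable]: "E \<in> sets N" using E by auto
  have Hs: "H k \<in> sets N" for k
  proof -
    have "H k = E \<inter> {x \<in> space N. s * 2 ^ k < g x}"
      using sets.sets_into_space[OF \<open>E \<in> sets N\<close>] by (auto simp: H_def)
    also have "\<dots> \<in> sets N" by measurable
    finally show ?thesis .
  qed
  have H: "H k \<in> fmeasurable N" for k
    by (rule fmeasurableI2[OF E]) (use Hs in \<open>auto simp: H_def\<close>)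
  have layers: "ennreal (g x) * indicator E x
      \<le> ennreal s * indicator E x + (\<Sum>k. ennreal (s * 2 ^ Suc k) * indicator (H k) x)" for x
  proof (cases "x \<in> E \<and> s < g x")
    case True
    have "\<exists>k. s * 2 ^ k < g x \<and> g x \<le> s * 2 ^ Suc k"
    proof -
      let ?P = "\<lambda>k. g x \<le> s * 2 ^ Suc k"
      obtain n where "g x / s < 2 ^ n" using real_arch_pow[of 2 "g x / s"] by auto
      then have "g x < s * 2 ^ n" using s by (simp add: field_simps)
      moreover have "s * 2 ^ n \<le> s * 2 ^ Suc n" using s by simp
      ultimately have "?P n" by linarith
      then have L: "?P (LEAST k. ?P k)" by (rule LeastI)
      have "s * 2 ^ (LEAST k. ?P k) < g x"
      proof (cases "LEAST k. ?P k")
        case 0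
        then show ?thesis using True by simp
      next
        case (Suc m)
        then have "\<not> ?P m" using not_less_Least[of m ?P] by simp
        then show ?thesis unfolding Suc by simp
      qed
      then show ?thesis using L by blast
    qed
    then obtain k where k: "s * 2 ^ k < g x" "g x \<le> s * 2 ^ Suc k" by blast
    have "ennreal (g x) * indicator E x \<le> ennreal (s * 2 ^ Suc k) * indicator (H k) x"
      using True k by (auto simp: H_def intro!: ennreal_leI)
    also have "\<dots> \<le> (\<Sum>k. ennreal (s * 2 ^ Suc k) * indicator (H k) x)"
      by (rule term_le_suminf_ennreal)
    finally show ?thesis by (rule add_increasing[rotated]) simp
  next
    case False
    then have "ennreal (g x) * indicator E x \<le> ennreal s * indicator E x"
      by (auto simp: indicator_def intro!: ennreal_leI)
    then show ?thesis by (rule add_increasing2[rotated]) simp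
  qed
  have H_small: "s * 2 ^ Suc k * measure N (H k) \<le> 2 * s * ?e * ?r ^ k" for k
  proof -
    have "measure N (H k) \<le> (W / (s * 2 ^ k)) powr q"
      unfolding H_def using s by (intro weak) auto
    also have "\<dots> = ?e / (2 ^ k) powr q"
    proof -
      have "(W / (s * 2 ^ k)) powr q = (W / s) powr q / (2 ^ k) powr q"
        using W s by (simp flip: powr_divide)
      then show ?thesis using Ws by simp
    qed
    finally have "s * 2 ^ Suc k * measure N (H k) \<le> s * 2 ^ Suc k * (?e / (2 ^ k) powr q)"
      using s by (intro mult_left_mono) auto
    also have "\<dots> = 2 * s * ?e * (2 ^ k / (2 ^ k) powr q)" by simp
    also have "2 ^ k / (2 ^ k) powr q = ?r ^ k"
    proof -
      have k2: "(2::real) ^ k = 2 powr real k" by (simp add: powr_realpow)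
      have "2 ^ k / (2 ^ k) powr q = 2 powr (real k - real k * q)"
        unfolding k2 by (simp add: powr_powr powr_diff)
      also have "real k - real k * q = (1 - q) * real k" by (simp add: algebra_simps)
      also have "2 powr ((1 - q) * real k) = ?r ^ k"
        by (simp add: powr_powr[symmetric] powr_realpow)
      finally show ?thesis .
    qed
    finally show ?thesis .
  qed
  have "(\<integral>\<^sup>+x\<in>E. ennreal (g x) \<partial>N)
      \<le> (\<integral>\<^sup>+x. ennreal s * indicator E x + (\<Sum>k. ennreal (s * 2 ^ Suc k) * indicator (H k) x) \<partial>N)"
    by (rule nn_integral_mono) (rule layers)
  also have "\<dots> = ennreal s * emeasure N E + (\<Sum>k. ennreal (s * 2 ^ Suc k) * emeasure N (H k))"
    using Hs by (simp add: nn_integral_add nn_integral_suminf nn_integral_cmult_indicator)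
  also have "\<dots> \<le> ennreal (s * ?e) + (\<Sum>k. ennreal (2 * s * ?e * ?r ^ k))"
  proof (intro add_mono suminf_le)
    show "ennreal s * emeasure N E \<le> ennreal (s * ?e)"
      using E s by (simp add: emeasure_eq_measure2 ennreal_mult)
    show "ennreal (s * 2 ^ Suc k) * emeasure N (H k) \<le> ennreal (2 * s * ?e * ?r ^ k)" for k
      using ennreal_leI[OF H_small[of k]] H[of k] s by (simp add: emeasure_eq_measure2 ennreal_mult)
  qed auto
  also have "(\<Sum>k. ennreal (2 * s * ?e * ?r ^ k)) = ennreal (2 * s * ?e * (1 / (1 - ?r)))"
    using r s e by (intro suminf_ennreal_eq sums_mult geometric_sums) auto
  also have "ennreal (s * ?e) + ennreal (2 * s * ?e * (1 / (1 - ?r)))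
      = ennreal (s * ?e + 2 * s * ?e * (1 / (1 - ?r)))"
    using r s e by (intro ennreal_plus[symmetric]) auto
  also have "s * ?e + 2 * s * ?e * (1 / (1 - ?r)) = (1 + 2 / (1 - ?r)) * (s * ?e)"
    by (simp add: algebra_simps)
  also have "\<dots> = (1 + 2 / (1 - ?r)) * W * ?e powr (1 - 1 / q)"
    unfolding se by simp
  finally show ?thesis unfolding kolmogorov_const_def .
qed

lemma conj_exp_facts:
  assumes "1 < p"
  shows "1 < conj_exp p" "1 / conj_exp p = 1 - 1 / p" "1 - 1 / conj_exp p = 1 / p"
  using assms by (auto simp: conj_exp_def field_simps)

lemma weight_level_measurable:
  assumes "weight w" "Q \<in> sets lebesgue"
  shows "{x \<in> Q. y < inverse (w x)} \<in> sets lebesgue"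
proof -
  note [measurable] = weight_measurable[OF assms(1)] assms(2)
  have "{x \<in> Q. y < inverse (w x)} = Q \<inter> {x \<in> space lebesgue. y < inverse (w x)}" by auto
  also have "\<dots> \<in> sets lebesgue" by measurable
  finally show ?thesis .
qed

lemma ApR_level_le:
  fixes w :: "real ^ 'n::finite \<Rightarrow> real"
  assumes w: "weight w" and p: "1 < p" and a: "0 \<le> a" "ApR_const p w = ennreal a"
    and Q: "Q \<in> cubes" and y: "0 < y"
  shows "y * measure (weight_measure w) {x \<in> Q. y < inverse (w x)} powr (1 / conj_exp p)
      * measure (weight_measure w) Q powr (1 / p) \<le> a * measure lebesgue Q"
proof -
  let ?N = "weight_measure w" and ?q = "conj_exp p"
  let ?S = "{x \<in> Q. y < inverse (w x)}"
  let ?F = "\<lambda>x. ennreal (indicator Q x * inverse (w x))"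
  note [measurable] = weight_measurable[OF w]
  have QN: "Q \<in> fmeasurable ?N" by (rule weight_fmeasurable_cube[OF w Q])
  have QL: "Q \<in> lmeasurable" "0 < measure lebesgue Q"
    using cubes_lmeasurable[OF Q] cubes_measure_pos[OF Q] by auto
  have S: "?S \<in> fmeasurable ?N"
    using weight_level_measurable[OF w fmeasurableD[OF QL(1)], of y]
    by (intro fmeasurableI2[OF QN]) auto
  have "{x. ennreal y < ?F x} = ?S"
    using y weight_pos[OF w] by (auto simp: indicator_def ennreal_less_iff split: if_splits)
  then have dist: "distr_fun w ?F y = ennreal (measure ?N ?S)"
    using S by (simp add: distr_fun_def emeasure_eq_measure2)
  have "ennreal y * ennpow (distr_fun w ?F y) (1 / ?q) \<le> lorentz_inf ?q w ?F"
    unfolding lorentz_inf_def using y by (intro SUP_upper) auto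
  then have "ennpow (emeasure ?N Q) (1 / p) * (ennreal y * ennpow (distr_fun w ?F y) (1 / ?q) / emeasure lebesgue Q)
      \<le> ennpow (emeasure ?N Q) (1 / p) * (lorentz_inf ?q w ?F / emeasure lebesgue Q)"
    by (intro mult_left_mono divide_right_mono_ennreal) auto
  also have "\<dots> \<le> ApR_const p w"
    unfolding ApR_const_def using Q by (rule SUP_upper)
  also have "\<dots> = ennreal a" by (rule a)
  also have "ennpow (emeasure ?N Q) (1 / p) * (ennreal y * ennpow (distr_fun w ?F y) (1 / ?q) / emeasure lebesgue Q)
      = ennreal (measure ?N Q powr (1 / p) * (y * measure ?N ?S powr (1 / ?q) / measure lebesgue Q))"
    unfolding dist using QN QL y
    by (simp add: emeasure_eq_measure2 ennpow_ennreal divide_ennreal flip: ennreal_mult)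
  finally have "measure ?N Q powr (1 / p) * (y * measure ?N ?S powr (1 / ?q) / measure lebesgue Q) \<le> a"
    using a by (simp add: ennreal_le_iff)
  then show ?thesis using QL by (simp add: field_simps)
qed

lemma weight_measure_pos:
  assumes "weight w" "Q \<in> sets lebesgue" "Q \<in> fmeasurable (weight_measure w)" "0 < measure lebesgue Q"
  shows "0 < measure (weight_measure w) Q"
proof (rule ccontr)
  assume "\<not> ?thesis"
  then have "emeasure (weight_measure w) Q = 0"
    using assms(3) by (simp add: emeasure_eq_measure2 zero_less_measure_iff)
  then have "emeasure lebesgue Q = 0" by (rule weight_measure_eq_0D[OF assms(1,2)])
  then show False using assms(4) by (simp add: measure_def)
qed

text \<open>
  If the constant vanished, then \<open>1 / w\<close> would vanish almost everywhere on the unit cube. Positivity is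
  needed for the upper bound when the norm on its right-hand side is infinite, since \<open>0 * \<infinity> = 0\<close>.
\<close>

lemma ApR_const_pos:
  fixes w :: "real ^ 'n::finite \<Rightarrow> real"
  assumes w: "weight w" and p: "1 < p" and a: "0 \<le> a" "ApR_const p w = ennreal a"
  shows "0 < a"
proof (rule ccontr)
  assume "\<not> 0 < a"
  then have a0: "a = 0" using a by simp
  let ?N = "weight_measure w"
  define Q :: "(real ^ 'n) set" where "Q = cbox 0 (\<chi> i. 0 $ i + 1)"
  have Q: "Q \<in> cubes" unfolding Q_def by (rule cbox_in_cubes) simp
  have QN: "Q \<in> fmeasurable ?N" by (rule weight_fmeasurable_cube[OF w Q])
  have QL: "Q \<in> sets lebesgue" using cubes_lmeasurable[OF Q] by auto
  note [measurable] = weight_measurable[OF w] QL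
  have Qpos: "0 < measure ?N Q"
    by (rule weight_measure_pos[OF w QL QN cubes_measure_pos[OF Q]])
  let ?S = "\<lambda>k::nat. {x \<in> Q. 1 / real (Suc k) < inverse (w x)}"
  have S: "?S k \<in> sets ?N" for k
    using weight_level_measurable[OF w QL] by simp
  have "emeasure ?N (?S k) = 0" for k
  proof -
    have "1 / real (Suc k) * measure ?N (?S k) powr (1 / conj_exp p) * measure ?N Q powr (1 / p) \<le> a * measure lebesgue Q"
      by (rule ApR_level_le[OF w p a Q]) simp
    then have "measure ?N (?S k) powr (1 / conj_exp p) \<le> 0"
      using Qpos a0 by (simp add: mult_le_0_iff divide_le_0_iff)
    then have "measure ?N (?S k) = 0" by (simp add: order_antisym_conv)
    moreover have "?S k \<in> fmeasurable ?N" using S by (intro fmeasurableI2[OF QN]) auto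
    ultimately show ?thesis by (simp add: emeasure_eq_measure2)
  qed
  then have "(\<Union>k. ?S k) \<in> null_sets ?N"
    using S by (intro null_sets_UN) (auto intro!: null_setsI)
  moreover have "Q \<subseteq> (\<Union>k. ?S k)"
  proof
    fix x assume "x \<in> Q"
    obtain k where "1 / real (Suc k) < inverse (w x)"
      using reals_Archimedean[of "inverse (w x)"] weight_pos[OF w, of x] by (auto simp: inverse_eq_divide)
    then show "x \<in> (\<Union>k. ?S k)" using \<open>x \<in> Q\<close> by blast
  qed
  ultimately have "Q \<in> null_sets ?N" using QN null_sets_subset[of _ ?N Q] by auto
  then show False using Qpos by (simp add: measure_def null_sets_def)
qed

text \<open>
  As \<open>|E|\<close> is the integral of \<open>1 / w\<close> over \<open>E\<close> with respect to the weighted measure, this is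
  Kolmogorov's inequality for \<open>1 / w\<close>.
\<close>

lemma ApR_restricted_inequality:
  fixes w :: "real ^ 'n::finite \<Rightarrow> real"
  assumes w: "weight w" and p: "1 < p" and a: "0 \<le> a" "ApR_const p w = ennreal a"
    and Q: "Q \<in> cubes" and E: "E \<in> sets lebesgue" "E \<subseteq> Q"
  shows "measure lebesgue E * measure (weight_measure w) Q powr (1 / p)
    \<le> kolmogorov_const (conj_exp p) * a * measure lebesgue Q * measure (weight_measure w) E powr (1 / p)"
proof -
  let ?N = "weight_measure w" and ?q = "conj_exp p"
  note q = conj_exp_facts[OF p]
  note [measurable] = weight_measurable[OF w] E(1)
  have QN: "Q \<in> fmeasurable ?N" by (rule weight_fmeasurable_cube[OF w Q])
  have QL: "Q \<in> lmeasurable" "0 < measure lebesgue Q"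
    using cubes_lmeasurable[OF Q] cubes_measure_pos[OF Q] by auto
  have Qpos: "0 < measure ?N Q" by (rule weight_measure_pos[OF w _ QN QL(2)]) (use QL in auto)
  have EN: "E \<in> fmeasurable ?N" using E by (intro fmeasurableI2[OF QN]) auto
  have EL: "E \<in> lmeasurable" using E by (intro fmeasurableI2[OF QL(1)]) auto
  define W where "W = a * measure lebesgue Q / measure ?N Q powr (1 / p)"
  have W: "0 < W" using ApR_const_pos[OF w p a] QL Qpos by (simp add: W_def)
  have "(\<integral>\<^sup>+x\<in>E. ennreal (inverse (w x)) \<partial>?N)
    \<le> ennreal (kolmogorov_const ?q * W * measure ?N E powr (1 - 1 / ?q))"
  proof (rule nn_integral_le_weak_Lq[OF q(1) W _ EN])
    show "(\<lambda>x. inverse (w x)) \<in> borel_measurable ?N"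
      by (simp add: measurable_cong_sets[OF sets_weight_measure refl])
    fix y :: real assume y: "0 < y"
    let ?S = "{x \<in> Q. y < inverse (w x)}" and ?T = "{x \<in> E. y < inverse (w x)}"
    have sets: "?S \<in> sets lebesgue" "?T \<in> sets lebesgue"
      by (rule weight_level_measurable[OF w fmeasurableD[OF QL(1)]], rule weight_level_measurable[OF w E(1)])
    have "measure ?N ?T \<le> measure ?N ?S"
      by (rule measure_mono_fmeasurable) (use E sets in \<open>auto intro!: fmeasurableI2[OF QN]\<close>)
    also have "\<dots> = (measure ?N ?S powr (1 / ?q)) powr ?q" using q by (simp add: powr_powr)
    also have "\<dots> \<le> (W / y) powr ?q"
    proof (rule powr_mono2)
      show "measure ?N ?S powr (1 / ?q) \<le> W / y"
        using ApR_level_le[OF w p a Q y] y Qpos unfolding W_def by (simp add: field_simps)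
    qed (use q in auto)
    finally show "measure ?N ?T \<le> (W / y) powr ?q" .
  qed
  then have "ennreal (measure lebesgue E) \<le> ennreal (kolmogorov_const ?q * W * measure ?N E powr (1 / p))"
    unfolding q(3)[symmetric]
    using EL by (simp add: emeasure_lebesgue_eq_weight_integral[OF w E(1), symmetric] emeasure_eq_measure2)
  then have "measure lebesgue E \<le> kolmogorov_const ?q * W * measure ?N E powr (1 / p)"
    using kolmogorov_const_pos[OF q(1)] W by (simp add: ennreal_le_iff)
  then show ?thesis using Qpos unfolding W_def by (simp add: field_simps)
qed

section \<open>The upper bound\<close>

text \<open>
  A half-open grid cell inherits the restricted inequality from the closed cube around it, which has the
  same Lebesgue measure and at least the same weighted measure.
\<close>

lemma laminar_weight_grid:
  fixes w :: "real ^ 'n::finite \<Rightarrow> real"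
  assumes w: "weight w" and p: "1 < p" and a: "0 \<le> a" "ApR_const p w = ennreal a"
  shows "laminar_weight lebesgue (weight_measure w) (grid B) p (kolmogorov_const (conj_exp p) * a)"
proof -
  let ?N = "weight_measure w" and ?A = "kolmogorov_const (conj_exp p) * a"
  have A_pos: "0 < ?A"
    using ApR_const_pos[OF w p a] kolmogorov_const_pos conj_exp_facts(1)[OF p] by simp
  have cell: "\<exists>P\<in>cubes. Q \<subseteq> P \<and> Q \<in> lmeasurable \<and> measure lebesgue Q = measure lebesgue P \<and> bounded Q"
    if grid: "Q \<in> grid B" for Q :: "(real ^ 'n) set"
  proof -
    obtain k m where Q: "Q = grid_cell B k m" using grid unfolding grid_def by blast
    obtain c :: "real ^ 'n" where c: "grid_cell B k m \<subseteq> cbox c (\<chi> i. c $ i + 2 powr k)"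
      "grid_cell B k m \<in> lmeasurable"
      "measure lebesgue (grid_cell B k m) = measure lebesgue (cbox c (\<chi> i. c $ i + 2 powr k))"
      using grid_cell_cube by blast
    have "cbox c (\<chi> i. c $ i + 2 powr k) \<in> cubes" by (rule cbox_in_cubes) simp
    then show ?thesis using c bounded_subset[OF bounded_cbox c(1)] unfolding Q by blast
  qed
  show ?thesis
  proof
    fix Q :: "(real ^ 'n) set" assume Q: "Q \<in> grid B"
    then obtain P where P: "P \<in> cubes" "Q \<subseteq> P" and Q': "Q \<in> lmeasurable" "bounded Q"
      and eq: "measure lebesgue Q = measure lebesgue P" using cell by blast
    show "Q \<in> fmeasurable lebesgue" by (rule Q')
    show QN: "Q \<in> fmeasurable ?N"
      by (rule weight_fmeasurable_bounded[OF w _ Q'(2)]) (use Q'(1) in auto)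
    show Qpos: "0 < measure lebesgue Q" using eq cubes_measure_pos[OF P(1)] by simp
    show "0 < measure ?N Q" by (rule weight_measure_pos[OF w _ QN Qpos]) (use Q'(1) in auto)
    fix E assume E: "E \<in> sets lebesgue" "E \<subseteq> Q"
    have "P \<in> fmeasurable ?N" by (rule weight_fmeasurable_cube[OF w P(1)])
    then have "measure ?N Q \<le> measure ?N P"
      using P(2) Q'(1) by (intro measure_mono_fmeasurable) auto
    then have "measure lebesgue E * measure ?N Q powr (1 / p) \<le> measure lebesgue E * measure ?N P powr (1 / p)"
      using p by (intro mult_left_mono powr_mono2) auto
    also have "\<dots> \<le> ?A * measure lebesgue P * measure ?N E powr (1 / p)"
      using E P by (intro ApR_restricted_inequality[OF w p a]) auto
    finally show "measure lebesgue E * measure ?N Q powr (1 / p) \<le> ?A * measure lebesgue Q * measure ?N E powr (1 / p)"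
      unfolding eq .
  next
    define P :: "(real ^ 'n) set" where "P = cbox 0 (\<chi> i. 0 $ i + 1)"
    have P: "P \<in> cubes" unfolding P_def by (rule cbox_in_cubes) simp
    have PN: "P \<in> fmeasurable ?N" by (rule weight_fmeasurable_cube[OF w P])
    have PL: "P \<in> sets lebesgue" using cubes_lmeasurable[OF P] by auto
    have Ppos: "0 < measure lebesgue P" "0 < measure ?N P"
      using cubes_measure_pos[OF P] weight_measure_pos[OF w PL PN] by auto
    have "measure lebesgue P * measure ?N P powr (1 / p) \<le> ?A * measure lebesgue P * measure ?N P powr (1 / p)"
      by (rule ApR_restricted_inequality[OF w p a P PL subset_refl])
    then have "(measure lebesgue P * measure ?N P powr (1 / p)) * 1 \<le> (measure lebesgue P * measure ?N P powr (1 / p)) * ?A"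
      by (simp add: ac_simps)
    then show "1 \<le> ?A" by (rule mult_left_le_imp_le) (use Ppos in auto)
  qed (use p laminar_grid in auto)
qed

lemma maximal_le_grid_sum:
  fixes w f :: "real ^ 'n::finite \<Rightarrow> real"
  assumes w: "weight w" and f: "f \<in> borel_measurable lebesgue"
  shows "maximal (\<lambda>y. f y * w y) x
    \<le> (\<Sum>B\<in>UNIV. ennreal (6 ^ CARD('n))
        * family_sup (grid B) (\<lambda>Q. (\<integral>\<^sup>+y\<in>Q. ennreal \<bar>f y\<bar> \<partial>weight_measure w) / emeasure lebesgue Q) x)"
  unfolding maximal_def
proof (rule SUP_least)
  let ?c = "\<lambda>Q. (\<integral>\<^sup>+y\<in>Q. ennreal \<bar>f y\<bar> \<partial>weight_measure w) / emeasure lebesgue Q"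
  note [measurable] = f weight_measurable[OF w]
  fix P :: "(real ^ 'n) set" assume "P \<in> {Q \<in> cubes. x \<in> Q}"
  then have P: "P \<in> cubes" "x \<in> P" by auto
  obtain B Q where Q: "Q \<in> grid B" "P \<subseteq> Q" "measure lebesgue Q \<le> 6 ^ CARD('n) * measure lebesgue P"
    using cube_in_grid_cell[OF P(1)] by blast
  have PL: "P \<in> lmeasurable" "0 < measure lebesgue P"
    using cubes_lmeasurable[OF P(1)] cubes_measure_pos[OF P(1)] by auto
  have QL: "Q \<in> lmeasurable"
  proof -
    obtain k m where "Q = grid_cell B k m" using Q(1) by (auto simp: grid_def)
    then show ?thesis using grid_cell_cube by metis
  qed
  have QPpos: "measure lebesgue P \<le> measure lebesgue Q"
    by (rule measure_mono_fmeasurable[OF Q(2)]) (use PL QL in auto)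
  have [measurable]: "P \<in> sets lebesgue" using PL by auto
  have "(\<integral>\<^sup>+y\<in>P. ennreal \<bar>f y * w y\<bar> \<partial>lebesgue) = (\<integral>\<^sup>+y\<in>P. ennreal \<bar>f y\<bar> \<partial>weight_measure w)"
  proof (subst nn_integral_weight_measure[OF w])
    have "ennreal \<bar>f y * w y\<bar> = ennreal (w y) * ennreal \<bar>f y\<bar>" for y
      using weight_pos[OF w, of y] by (simp add: abs_mult mult.commute flip: ennreal_mult)
    then show "(\<integral>\<^sup>+y\<in>P. ennreal \<bar>f y * w y\<bar> \<partial>lebesgue) = (\<integral>\<^sup>+y. ennreal (w y) * (ennreal \<bar>f y\<bar> * indicator P y) \<partial>lebesgue)"
      by (simp add: mult.assoc)
  qed measurable
  also have "\<dots> \<le> (\<integral>\<^sup>+y\<in>Q. ennreal \<bar>f y\<bar> \<partial>weight_measure w)"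
    using Q(2) by (intro nn_integral_mono mult_left_mono) (auto simp: indicator_def)
  finally have "(\<integral>\<^sup>+y\<in>P. ennreal \<bar>f y * w y\<bar> \<partial>lebesgue) / emeasure lebesgue P
      \<le> (\<integral>\<^sup>+y\<in>Q. ennreal \<bar>f y\<bar> \<partial>weight_measure w) / emeasure lebesgue P"
    by (rule divide_right_mono_ennreal)
  also have "\<dots> \<le> ennreal (6 ^ CARD('n)) * ?c Q"
  proof -
    have inv: "inverse (emeasure lebesgue P) \<le> ennreal (6 ^ CARD('n)) * inverse (emeasure lebesgue Q)"
    proof -
      have "inverse (measure lebesgue P) \<le> 6 ^ CARD('n) * inverse (measure lebesgue Q)"
        using Q(3) PL QPpos by (simp add: field_simps)
      then have "ennreal (inverse (measure lebesgue P)) \<le> ennreal (6 ^ CARD('n) * inverse (measure lebesgue Q))"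
        by (rule ennreal_leI)
      then show ?thesis using PL QL QPpos
        by (simp add: emeasure_eq_measure2 inverse_ennreal ennreal_mult)
    qed
    then show ?thesis
      using mult_left_mono[OF inv, of "\<integral>\<^sup>+y\<in>Q. ennreal \<bar>f y\<bar> \<partial>weight_measure w"]
      by (simp add: divide_ennreal_def ac_simps)
  qed
  also have "\<dots> \<le> ennreal (6 ^ CARD('n)) * family_sup (grid B) ?c x"
    by (intro mult_left_mono family_sup_upper) (use Q P in auto)
  also have "\<dots> \<le> (\<Sum>B\<in>UNIV. ennreal (6 ^ CARD('n)) * family_sup (grid B) ?c x)"
    by (rule member_le_sum) auto
  finally show "(\<integral>\<^sup>+y\<in>P. ennreal \<bar>f y * w y\<bar> \<partial>lebesgue) / emeasure lebesgue P
      \<le> (\<Sum>B\<in>UNIV. ennreal (6 ^ CARD('n)) * family_sup (grid B) ?c x)" .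
qed

text \<open>
  The factors \<open>2\<^sup>n\<close> and \<open>6\<^sup>n\<close> count the grids and compare cubes with cells, and 4 is the loss of
  \<open>nn_integral_family_sup_function\<close>. The rest is \<open>restricted_const\<close> without the \<open>A\<^sub>p\<^sup>\<R>\<close> constant.
\<close>

definition maximal_const :: "real \<Rightarrow> nat \<Rightarrow> real" where
  "maximal_const p n = 2 ^ n * (6 ^ n * (4 * (p / (p - 1) * (2 * kolmogorov_const (conj_exp p)) powr (p + 1)
     * (2 powr (1 - 1 / p) / (1 - 2 powr (- (1 / p)))))))"

lemma maximal_const_pos: "1 < p \<Longrightarrow> 0 < maximal_const p n"
  unfolding maximal_const_def
  using kolmogorov_const_pos[of "conj_exp p"] conj_exp_facts(1)[of p] powr_less_one[of 2 "- (1 / p)"]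
  by (simp add: zero_less_divide_iff)

lemma nn_integral_maximal_le:
  fixes w f :: "real ^ 'n::finite \<Rightarrow> real"
  assumes w: "weight w" and p: "1 < p" and a: "0 \<le> a" "ApR_const p w = ennreal a"
    and f: "f \<in> borel_measurable lebesgue" and F: "F \<in> fmeasurable (weight_measure w)"
  shows "(\<integral>\<^sup>+x\<in>F. maximal (\<lambda>y. f y * w y) x \<partial>lebesgue)
    \<le> ennreal (maximal_const p CARD('n) * a powr (p + 1) * measure (weight_measure w) F powr (1 / p))
      * lorentz_1 (conj_exp p) w (\<lambda>x. ennreal \<bar>f x\<bar>)"
proof -
  let ?N = "weight_measure w" and ?A = "kolmogorov_const (conj_exp p) * a"
  let ?c = "\<lambda>Q. (\<integral>\<^sup>+y\<in>Q. ennreal \<bar>f y\<bar> \<partial>weight_measure w) / emeasure lebesgue Q"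
  define I where "I = (\<integral>\<^sup>+y\<in>{0<..}. ennpow (distr_fun w (\<lambda>x. ennreal \<bar>f x\<bar>) y) (1 / conj_exp p) \<partial>lborel)"
  define k where "k = laminar_weight.restricted_const p ?A"
  have q: "1 < conj_exp p" "0 < kolmogorov_const (conj_exp p)"
    using conj_exp_facts(1)[OF p] kolmogorov_const_pos by auto
  have k: "k = p / (p - 1) * (2 * kolmogorov_const (conj_exp p)) powr (p + 1)
     * (2 powr (1 - 1 / p) / (1 - 2 powr (- (1 / p)))) * a powr (p + 1)"
  proof -
    interpret laminar_weight lebesgue ?N "grid {}" p ?A by (rule laminar_weight_grid[OF w p a])
    show ?thesis unfolding k_def restricted_const_def density_const_def
      using q a by (simp add: powr_mult mult.assoc[symmetric])
  qed
  have [measurable]: "F \<in> sets lebesgue" using F by auto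
  have meas[measurable]: "family_sup (grid B) ?c \<in> borel_measurable lebesgue" for B
  proof -
    interpret laminar_weight lebesgue ?N "grid B" p ?A by (rule laminar_weight_grid[OF w p a])
    show ?thesis using fmeas by (intro borel_measurable_family_sup countable_grid) auto
  qed
  have "{x. y < \<bar>f x\<bar>} = {x. ennreal y < ennreal \<bar>f x\<bar>}" if "0 < y" for y
    using that by (auto simp: ennreal_less_iff)
  then have I': "I = (\<integral>\<^sup>+y\<in>{0<..}. ennpow (emeasure ?N {x \<in> space lebesgue. y < \<bar>f x\<bar>}) (1 - 1 / p) \<partial>lborel)"
    unfolding I_def distr_fun_def conj_exp_facts(2)[OF p]
    by (intro nn_integral_cong) (auto simp: indicator_def)
  have single: "(\<integral>\<^sup>+x\<in>F. family_sup (grid B) ?c x \<partial>lebesgue) \<le> ennreal (4 * k * measure ?N F powr (1 / p)) * I" for B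
  proof -
    interpret laminar_weight lebesgue ?N "grid B" p ?A by (rule laminar_weight_grid[OF w p a])
    show ?thesis unfolding I' k_def
      by (rule nn_integral_family_sup_function[OF countable_grid _ F]) (use f in measurable)
  qed
  have "(\<integral>\<^sup>+x\<in>F. maximal (\<lambda>y. f y * w y) x \<partial>lebesgue)
      \<le> (\<integral>\<^sup>+x. (\<Sum>B\<in>UNIV. ennreal (6 ^ CARD('n)) * (family_sup (grid B) ?c x * indicator F x)) \<partial>lebesgue)"
  proof (rule nn_integral_mono)
    fix x
    show "maximal (\<lambda>y. f y * w y) x * indicator F x
        \<le> (\<Sum>B\<in>UNIV. ennreal (6 ^ CARD('n)) * (family_sup (grid B) ?c x * indicator F x))"
      using maximal_le_grid_sum[OF w f, of x] by (cases "x \<in> F") auto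
  qed
  also have "\<dots> = (\<Sum>B\<in>UNIV. ennreal (6 ^ CARD('n)) * (\<integral>\<^sup>+x\<in>F. family_sup (grid B) ?c x \<partial>lebesgue))"
    by (simp add: nn_integral_sum nn_integral_cmult)
  also have "\<dots> \<le> (\<Sum>B\<in>(UNIV :: 'n set set). ennreal (6 ^ CARD('n)) * (ennreal (4 * k * measure ?N F powr (1 / p)) * I))"
    by (intro sum_mono mult_left_mono single) auto
  also have "\<dots> = ennreal (2 ^ CARD('n)) * (ennreal (6 ^ CARD('n)) * (ennreal (4 * k * measure ?N F powr (1 / p)) * I))"
    by (simp add: card_Pow flip: Pow_UNIV ennreal_power)
  also have "\<dots> = ennreal (maximal_const p CARD('n) * a powr (p + 1) * measure ?N F powr (1 / p)) * I"
  proof -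
    have "0 \<le> 4 * k * measure ?N F powr (1 / p)"
    proof -
      have "4 * k = maximal_const p 0 * a powr (p + 1)"
        unfolding k maximal_const_def by simp
      then have "0 \<le> 4 * k" using maximal_const_pos[OF p, of 0] by simp
      then show ?thesis by simp
    qed
    then have "ennreal (2 ^ CARD('n)) * (ennreal (6 ^ CARD('n)) * ennreal (4 * k * measure ?N F powr (1 / p)))
        = ennreal (2 ^ CARD('n) * (6 ^ CARD('n) * (4 * k * measure ?N F powr (1 / p))))"
      by (simp add: ennreal_mult)
    also have "2 ^ CARD('n) * (6 ^ CARD('n) * (4 * k * measure ?N F powr (1 / p)))
        = maximal_const p CARD('n) * a powr (p + 1) * measure ?N F powr (1 / p)"
      unfolding k maximal_const_def by (simp only: mult.assoc)
    finally show ?thesis by (simp add: mult.assoc[symmetric])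
  qed
  also have "\<dots> \<le> ennreal (maximal_const p CARD('n) * a powr (p + 1) * measure ?N F powr (1 / p))
      * lorentz_1 (conj_exp p) w (\<lambda>x. ennreal \<bar>f x\<bar>)"
  proof (rule mult_left_mono)
    have "1 * I \<le> ennreal (conj_exp p) * I" using q by (intro mult_right_mono) (auto simp: ennreal_1[symmetric] simp del: ennreal_1)
    then show "I \<le> lorentz_1 (conj_exp p) w (\<lambda>x. ennreal \<bar>f x\<bar>)" by (simp add: lorentz_1_def I_def)
  qed simp
  finally show ?thesis .
qed

text \<open>
  Let \<open>H\<close> be a level set of \<open>M(f w) / w\<close>. Its weighted measure need not be finite a priori, so the
  integral estimate is applied to the part of \<open>H\<close> in a ball, where one may divide by a power of the
  weighted measure; the resulting bound does not depend on the radius.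
\<close>

lemma maximal_weak_bound:
  fixes w f :: "real ^ 'n::finite \<Rightarrow> real"
  assumes w: "weight w" and p: "1 < p" and a: "0 \<le> a" "ApR_const p w = ennreal a"
    and f: "f \<in> borel_measurable lebesgue"
  shows "lorentz_inf (conj_exp p) w (\<lambda>x. maximal (\<lambda>y. f y * w y) x / ennreal (w x))
    \<le> ennreal (maximal_const p CARD('n)) * ennpow (ApR_const p w) (p + 1)
      * lorentz_1 (conj_exp p) w (\<lambda>x. ennreal \<bar>f x\<bar>)"
proof -
  let ?N = "weight_measure w" and ?q = "conj_exp p"
  define C where "C = maximal_const p CARD('n) * a powr (p + 1)"
  define L where "L = lorentz_1 ?q w (\<lambda>x. ennreal \<bar>f x\<bar>)"
  let ?G = "\<lambda>x. maximal (\<lambda>y. f y * w y) x / ennreal (w x)"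
  note q = conj_exp_facts[OF p]
  have C: "0 < C"
    using maximal_const_pos[OF p] ApR_const_pos[OF w p a] by (simp add: C_def)
  have rhs: "ennreal (maximal_const p CARD('n)) * ennpow (ApR_const p w) (p + 1) = ennreal C"
    using maximal_const_pos[OF p, of "CARD('n)"] a by (simp add: C_def ennpow_ennreal ennreal_mult)
  have "lorentz_inf ?q w ?G \<le> ennreal C * L"
  proof (cases "L = \<infinity>")
    case True
    then show ?thesis using C by (simp add: ennreal_mult_top)
  next
    case False
    then obtain b where b: "L = ennreal b" "0 \<le> b" by (cases L) auto
    show ?thesis
      unfolding lorentz_inf_def
    proof (rule SUP_least)
      fix y :: real assume "y \<in> {0<..}"
      then have y: "0 < y" by simp
      define H where "H = {x. ?G x > ennreal y}"
      define Hr where "Hr r = H \<inter> ball 0 (real r)" for r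
      have "emeasure ?N H \<le> ennreal ((C * b / y) powr ?q)"
      proof (cases "H \<in> sets lebesgue")
        case False
        then have "emeasure ?N H = 0" by (intro emeasure_notin_sets) simp
        then show ?thesis by simp
      next
        case True
        have Hr: "Hr r \<in> sets lebesgue" "Hr r \<in> fmeasurable ?N" for r
        proof -
          show "Hr r \<in> sets lebesgue" unfolding Hr_def using True by (intro sets.Int) auto
          then show "Hr r \<in> fmeasurable ?N"
            by (rule weight_fmeasurable_bounded[OF w]) (auto simp: Hr_def intro: bounded_subset[OF bounded_ball])
        qed
        have bound: "measure ?N (Hr r) \<le> (C * b / y) powr ?q" for r
        proof (cases "measure ?N (Hr r) = 0")
          case False
          then have m: "0 < measure ?N (Hr r)" by (simp add: zero_less_measure_iff)
          note [measurable] = weight_measurable[OF w] Hr(1)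
          have "ennreal y * emeasure ?N (Hr r) = (\<integral>\<^sup>+x. ennreal y * (ennreal (w x) * indicator (Hr r) x) \<partial>lebesgue)"
            by (simp add: emeasure_weight_measure[OF w Hr(1)] nn_integral_cmult)
          also have "\<dots> \<le> (\<integral>\<^sup>+x\<in>Hr r. maximal (\<lambda>y. f y * w y) x \<partial>lebesgue)"
          proof (rule nn_integral_mono)
            fix x
            have "ennreal y * ennreal (w x) \<le> maximal (\<lambda>y. f y * w y) x" if "x \<in> H"
            proof -
              have "ennreal y * ennreal (w x) \<le> ?G x * ennreal (w x)"
                using that by (intro mult_right_mono) (auto simp: H_def)
              also have "\<dots> = maximal (\<lambda>y. f y * w y) x"
                using weight_pos[OF w, of x] by (simp add: ennreal_divide_times ennreal_divide_self)
              finally show ?thesis .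
            qed
            then show "ennreal y * (ennreal (w x) * indicator (Hr r) x)
                \<le> maximal (\<lambda>y. f y * w y) x * indicator (Hr r) x"
              by (auto simp: Hr_def indicator_def)
          qed
          also have "\<dots> \<le> ennreal (C * measure ?N (Hr r) powr (1 / p)) * L"
            unfolding C_def L_def by (rule nn_integral_maximal_le[OF w p a f Hr(2)])
          finally have "ennreal (y * measure ?N (Hr r)) \<le> ennreal (C * measure ?N (Hr r) powr (1 / p) * b)"
            using Hr(2)[of r] y C b by (simp add: emeasure_eq_measure2 ennreal_mult)
          then have "y * measure ?N (Hr r) \<le> C * measure ?N (Hr r) powr (1 / p) * b"
            using C b by (simp add: ennreal_le_iff)
          moreover have q_sum: "1 / ?q + 1 / p = 1" by (simp add: q(2))
          then have "measure ?N (Hr r) = measure ?N (Hr r) powr (1 / ?q) * measure ?N (Hr r) powr (1 / p)"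
            using m by (simp add: q_sum flip: powr_add)
          ultimately have "(y * measure ?N (Hr r) powr (1 / ?q)) * measure ?N (Hr r) powr (1 / p)
              \<le> (C * b) * measure ?N (Hr r) powr (1 / p)"
            by (simp add: ac_simps)
          then have "y * measure ?N (Hr r) powr (1 / ?q) \<le> C * b"
            by (rule mult_right_le_imp_le) (use m in simp)
          then have "measure ?N (Hr r) powr (1 / ?q) \<le> C * b / y"
            using y by (simp add: field_simps)
          then have "(measure ?N (Hr r) powr (1 / ?q)) powr ?q \<le> (C * b / y) powr ?q"
            using q(1) by (intro powr_mono2) auto
          then show ?thesis using q(1) m by (simp add: powr_powr)
        qed simp
        have "H = (\<Union>r. Hr r)"
          unfolding Hr_def using reals_Archimedean2 by (auto simp: dist_norm)
        moreover have "(SUP r. emeasure ?N (Hr r)) = emeasure ?N (\<Union>r. Hr r)"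
          by (rule SUP_emeasure_incseq) (use Hr(1) in \<open>auto simp: incseq_def Hr_def\<close>)
        ultimately have "emeasure ?N H = (SUP r. emeasure ?N (Hr r))" by simp
        also have "\<dots> \<le> ennreal ((C * b / y) powr ?q)"
          using Hr(2) bound by (intro SUP_least) (auto simp: emeasure_eq_measure2 intro!: ennreal_leI)
        finally show ?thesis .
      qed
      then have "ennpow (emeasure ?N H) (1 / ?q) \<le> ennpow (ennreal ((C * b / y) powr ?q)) (1 / ?q)"
        using q by (intro ennpow_mono) auto
      also have "\<dots> = ennreal (C * b / y)"
        using q C b y by (simp add: ennpow_ennreal powr_powr)
      finally have "ennreal y * ennpow (emeasure ?N H) (1 / ?q) \<le> ennreal y * ennreal (C * b / y)"
        by (rule mult_left_mono) simp
      also have "\<dots> = ennreal C * L" using C b y by (simp flip: ennreal_mult)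
      finally show "ennreal y * ennpow (distr_fun w ?G y) (1 / ?q) \<le> ennreal C * L"
        unfolding distr_fun_def H_def .
    qed
  qed
  then show ?thesis unfolding rhs L_def .
qed

section \<open>The converse\<close>

text \<open>
  Lower semicontinuity of the maximal function. The cubes are closed, so a cube through \<open>x\<close> is first
  enlarged a little to contain a neighbourhood of \<open>x\<close>; its average drops by a factor close to 1 at
  most.
\<close>

lemma open_maximal_greater:
  fixes g :: "real ^ 'n::finite \<Rightarrow> real"
  shows "open {x. t < maximal g x}"
proof (subst open_subopen, rule ballI)
  let ?J = "\<lambda>Q. \<integral>\<^sup>+y\<in>Q. ennreal \<bar>g y\<bar> \<partial>lebesgue"
  fix x assume "x \<in> {x. t < maximal g x}"
  then obtain Q where Q: "Q \<in> cubes" "x \<in> Q" "t < ?J Q / emeasure lebesgue Q"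
    unfolding maximal_def by (auto simp: less_SUP_iff)
  then obtain a :: "real ^ 'n" and l where Qa: "Q = cbox a (\<chi> i. a $ i + l)" and l: "0 < l"
    by (auto simp: cubes_def)
  define R where "R e = cbox (\<chi> i. a $ i - e) (\<chi> i. (\<chi> i. a $ i - e) $ i + (l + 2 * e))" for e
  have mR: "emeasure lebesgue (R e) = ennreal ((l + 2 * e) ^ CARD('n))" if "0 \<le> e" for e
    unfolding R_def using that l
    by (subst emeasure_eq_measure2) (auto simp only: measure_lebesgue_cube lmeasurable_cbox)
  have mQ: "emeasure lebesgue Q = ennreal (l ^ CARD('n))"
    unfolding Qa using l by (subst emeasure_eq_measure2) (auto simp only: measure_lebesgue_cube lmeasurable_cbox less_imp_le)
  obtain e where e: "0 < e" "t < ?J Q / ennreal ((l + 2 * e) ^ CARD('n))"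
  proof (cases "?J Q = \<infinity>")
    case True
    have "?J Q / ennreal ((l + 2 * 1) ^ CARD('n)) = \<infinity>"
      unfolding True by (simp add: ennreal_top_divide)
    moreover have "t < \<infinity>" using Q(3) by (metis less_le_trans top_greatest infinity_ennreal_def)
    ultimately show ?thesis using that[of 1] by simp
  next
    case False
    then obtain j where j: "?J Q = ennreal j" "0 \<le> j" by (cases "?J Q") auto
    have "((\<lambda>e. ennreal (j / (l + 2 * e) ^ CARD('n))) \<longlongrightarrow> ennreal (j / (l + 2 * 0) ^ CARD('n))) (at_right 0)"
      using l by (intro tendsto_intros tendsto_ennrealI) auto
    moreover have "t < ennreal (j / (l + 2 * 0) ^ CARD('n))"
      using Q(3) l j unfolding mQ by (simp add: divide_ennreal)
    ultimately have "\<forall>\<^sub>F e in at_right 0. t < ennreal (j / (l + 2 * e) ^ CARD('n))"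
      by (rule order_tendstoD)
    then have "\<forall>\<^sub>F e in at_right 0. (0::real) < e \<and> t < ennreal (j / (l + 2 * e) ^ CARD('n))"
      using eventually_at_right_less by eventually_elim auto
    then obtain e where "(0::real) < e" "t < ennreal (j / (l + 2 * e) ^ CARD('n))"
      using eventually_happens'[OF trivial_limit_at_right_real] by blast
    then show ?thesis using that[of e] l j by (simp add: divide_ennreal)
  qed
  let ?U = "box (\<chi> i. a $ i - e) (\<chi> i. a $ i + l + e)"
  have "a $ i - e < x $ i \<and> x $ i < a $ i + l + e" for i
  proof -
    have "a $ i \<le> x $ i" "x $ i \<le> a $ i + l" using Q(2) unfolding Qa by (auto simp: mem_box_cart)
    then show ?thesis using e(1) by linarith
  qed
  then have "x \<in> ?U" by (simp add: mem_box_cart)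
  moreover have "?U \<subseteq> {x. t < maximal g x}"
  proof
    fix z assume z: "z \<in> ?U"
    have "R e \<in> cubes" unfolding R_def by (rule cbox_in_cubes) (use l e in simp)
    moreover have "z \<in> R e" using z by (auto simp: R_def mem_box_cart algebra_simps less_imp_le)
    ultimately have "?J (R e) / emeasure lebesgue (R e) \<le> maximal g z"
      unfolding maximal_def by (intro SUP_upper) auto
    moreover have "?J Q \<le> ?J (R e)"
    proof -
      have "Q \<subseteq> R e"
      proof
        fix z assume "z \<in> Q"
        then have z: "a $ i \<le> z $ i" "z $ i \<le> a $ i + l" for i unfolding Qa by (auto simp: mem_box_cart)
        have "a $ i - e \<le> z $ i \<and> z $ i \<le> (a $ i - e) + (l + 2 * e)" for i
          using z[of i] e(1) by linarith
        then show "z \<in> R e" by (simp add: R_def mem_box_cart)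
      qed
      then show ?thesis by (intro nn_integral_mono mult_left_mono) (auto simp: indicator_def)
    qed
    then have "?J Q / ennreal ((l + 2 * e) ^ CARD('n)) \<le> ?J (R e) / emeasure lebesgue (R e)"
      using e(1) by (simp add: mR divide_right_mono_ennreal)
    ultimately show "z \<in> {x. t < maximal g x}" using e(2) by (auto intro: less_le_trans)
  qed
  ultimately show "\<exists>T. open T \<and> x \<in> T \<and> T \<subseteq> {x. t < maximal g x}" using open_box by blast
qed

lemma borel_measurable_maximal:
  fixes g :: "real ^ 'n::finite \<Rightarrow> real"
  shows "maximal g \<in> borel_measurable lebesgue"
proof -
  have "maximal g \<in> borel_measurable borel"
    by (rule borel_measurableI_greater) (use open_maximal_greater[of _ g] in simp)
  then show ?thesis by (simp add: measurable_completion)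
qed

text \<open>
  The distribution function of \<open>\<chi>\<^sub>Q\<close> equals the measure of \<open>Q\<close> on \<open>(0, 1)\<close> and 0 afterwards.
\<close>

lemma lorentz_1_indicator:
  fixes w :: "real ^ 'n::finite \<Rightarrow> real"
  assumes "1 < p" and Q: "Q \<in> fmeasurable (weight_measure w)"
  shows "lorentz_1 (conj_exp p) w (\<lambda>x. ennreal \<bar>indicator Q x\<bar>)
    \<le> ennreal (conj_exp p * measure (weight_measure w) Q powr (1 / conj_exp p))"
proof -
  let ?N = "weight_measure w" and ?q = "conj_exp p"
  note q = conj_exp_facts[OF assms(1)]
  have "(\<integral>\<^sup>+y\<in>{0<..}. ennpow (distr_fun w (\<lambda>x. ennreal \<bar>indicator Q x\<bar>) y) (1 / ?q) \<partial>lborel)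
      \<le> (\<integral>\<^sup>+y. ennreal (measure ?N Q powr (1 / ?q)) * indicator {0<..<1::real} y \<partial>lborel)"
  proof (rule nn_integral_mono)
    fix y :: real
    have "{x. ennreal y < ennreal \<bar>indicator Q x\<bar>} = (if y < 1 then Q else {})" if "0 < y"
      using that by (auto simp: indicator_def ennreal_less_iff simp flip: ennreal_1 split: if_splits)
    then show "ennpow (distr_fun w (\<lambda>x. ennreal \<bar>indicator Q x\<bar>) y) (1 / ?q) * indicator {0<..} y
        \<le> ennreal (measure ?N Q powr (1 / ?q)) * indicator {0<..<1::real} y"
      using Q ennpow_ennreal[of 0 "1 / ?q"]
      by (auto simp: distr_fun_def emeasure_eq_measure2 ennpow_ennreal indicator_def)
  qed
  also have "\<dots> = ennreal (measure ?N Q powr (1 / ?q))"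
    by (simp add: nn_integral_cmult_indicator)
  finally have "lorentz_1 ?q w (\<lambda>x. ennreal \<bar>indicator Q x\<bar>)
      \<le> ennreal ?q * ennreal (measure ?N Q powr (1 / ?q))"
    unfolding lorentz_1_def by (rule mult_left_mono) simp
  then show ?thesis using q(1) by (simp add: ennreal_mult)
qed

text \<open>
  Test the inequality on \<open>f = \<chi>\<^sub>Q\<close>. With \<open>v\<close> the average of \<open>w\<close> over \<open>Q\<close>, the level set of
  \<open>\<chi>\<^sub>Q / w\<close> at height \<open>y\<close> is contained in that of \<open>M(f w) / w\<close> at height \<open>y v\<close>.
\<close>

lemma ApR_const_le_of_weak_bound:
  fixes w :: "real ^ 'n::finite \<Rightarrow> real"
  assumes w: "weight w" and p: "1 < p" and C: "0 < C"
    and bound: "\<And>f. f \<in> borel_measurable lebesgue \<Longrightarrow>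
       lorentz_inf (conj_exp p) w (\<lambda>x. maximal (\<lambda>y. f y * w y) x / ennreal (w x))
       \<le> ennreal C * lorentz_1 (conj_exp p) w (\<lambda>x. ennreal \<bar>f x\<bar>)"
  shows "ApR_const p w \<le> ennreal (conj_exp p * C)"
  unfolding ApR_const_def
proof (rule SUP_least)
  fix Q :: "(real ^ 'n) set" assume Q: "Q \<in> cubes"
  let ?N = "weight_measure w" and ?q = "conj_exp p"
  note q = conj_exp_facts[OF p]
  note [measurable] = weight_measurable[OF w]
  have QN: "Q \<in> fmeasurable ?N" by (rule weight_fmeasurable_cube[OF w Q])
  have QL: "Q \<in> lmeasurable" "0 < measure lebesgue Q"
    using cubes_lmeasurable[OF Q] cubes_measure_pos[OF Q] by auto
  have [measurable]: "Q \<in> sets lebesgue" using QL by auto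
  have Qpos: "0 < measure ?N Q" by (rule weight_measure_pos[OF w _ QN QL(2)]) simp
  let ?h = "\<lambda>y. indicator Q y * w y"
  let ?G = "\<lambda>x. maximal ?h x / ennreal (w x)"
  let ?F = "\<lambda>x. ennreal (indicator Q x * inverse (w x))"
  define v where "v = measure ?N Q / measure lebesgue Q"
  have v: "0 < v" using Qpos QL by (simp add: v_def)
  have maxQ: "ennreal v \<le> maximal ?h x" if "x \<in> Q" for x
  proof -
    have "ennreal v = emeasure ?N Q / emeasure lebesgue Q"
      using QN QL by (simp add: v_def emeasure_eq_measure2 divide_ennreal)
    also have "emeasure ?N Q = (\<integral>\<^sup>+y\<in>Q. ennreal \<bar>?h y\<bar> \<partial>lebesgue)"
      unfolding emeasure_weight_measure[OF w \<open>Q \<in> sets lebesgue\<close>]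
      using weight_pos[OF w] by (intro nn_integral_cong) (auto simp: indicator_def abs_of_pos)
    also have "\<dots> / emeasure lebesgue Q \<le> maximal ?h x"
      unfolding maximal_def using Q that by (intro SUP_upper) auto
    finally show ?thesis .
  qed
  have norm: "lorentz_inf ?q w ?G \<le> ennreal (C * (?q * measure ?N Q powr (1 / ?q)))"
  proof -
    have "lorentz_inf ?q w ?G \<le> ennreal C * lorentz_1 ?q w (\<lambda>x. ennreal \<bar>indicator Q x\<bar>)"
      by (rule bound) measurable
    also have "\<dots> \<le> ennreal C * ennreal (?q * measure ?N Q powr (1 / ?q))"
      by (intro mult_left_mono lorentz_1_indicator p QN) simp
    finally show ?thesis using C q(1) by (simp add: ennreal_mult)
  qed
  have level: "ennreal y * ennpow (distr_fun w ?F y) (1 / ?q)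
      \<le> ennreal (C * ?q * measure ?N Q powr (1 / ?q) / v)" if y: "0 < y" for y
  proof -
    let ?S = "{x. ?F x > ennreal y}" and ?T = "{x. ?G x > ennreal (y * v)}"
    have "?T = {x \<in> space lebesgue. ennreal (y * v) < ?G x}" by simp
    also have "\<dots> \<in> sets lebesgue"
      by (intro borel_measurable_less borel_measurable_divide_ennreal borel_measurable_maximal) measurable
    finally have T: "?T \<in> sets ?N" by simp
    have ST: "?S \<subseteq> ?T"
    proof
      fix x assume "x \<in> ?S"
      then have x: "x \<in> Q" "y < inverse (w x)"
        using y by (cases "x \<in> Q"; simp add: ennreal_less_iff)+
      have "ennreal (y * v) < ennreal (v / w x)"
        using x(2) v weight_pos[OF w, of x] y by (intro ennreal_lessI) (auto simp: field_simps)
      also have "\<dots> = ennreal v / ennreal (w x)"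
        using v weight_pos[OF w, of x] by (simp add: divide_ennreal)
      also have "\<dots> \<le> ?G x" by (intro divide_right_mono_ennreal maxQ x)
      finally show "x \<in> ?T" by simp
    qed
    have "ennpow (distr_fun w ?F y) (1 / ?q) \<le> ennpow (distr_fun w ?G (y * v)) (1 / ?q)"
      unfolding distr_fun_def using q ST T by (intro ennpow_mono emeasure_mono) auto
    then have "ennreal y * ennpow (distr_fun w ?F y) (1 / ?q) \<le> ennreal y * ennpow (distr_fun w ?G (y * v)) (1 / ?q)"
      by (rule mult_left_mono) simp
    also have "\<dots> = ennreal (1 / v) * (ennreal (y * v) * ennpow (distr_fun w ?G (y * v)) (1 / ?q))"
      using v y by (simp add: mult.assoc[symmetric] flip: ennreal_mult)
    also have "\<dots> \<le> ennreal (1 / v) * lorentz_inf ?q w ?G"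
      unfolding lorentz_inf_def using v y by (intro mult_left_mono SUP_upper) auto
    also have "\<dots> \<le> ennreal (1 / v) * ennreal (C * (?q * measure ?N Q powr (1 / ?q)))"
      by (rule mult_left_mono[OF norm]) simp
    also have "\<dots> = ennreal (C * ?q * measure ?N Q powr (1 / ?q) / v)"
      using v C q by (simp add: mult.assoc flip: ennreal_mult)
    finally show ?thesis .
  qed
  have "lorentz_inf ?q w ?F \<le> ennreal (C * ?q * measure ?N Q powr (1 / ?q) / v)"
    unfolding lorentz_inf_def by (rule SUP_least) (use level in simp)
  then have "ennpow (emeasure ?N Q) (1 / p) * (lorentz_inf ?q w ?F / emeasure lebesgue Q)
      \<le> ennpow (emeasure ?N Q) (1 / p) * (ennreal (C * ?q * measure ?N Q powr (1 / ?q) / v) / emeasure lebesgue Q)"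
    by (intro mult_left_mono divide_right_mono_ennreal) auto
  also have "\<dots> = ennreal (measure ?N Q powr (1 / p) * (C * ?q * measure ?N Q powr (1 / ?q) / v / measure lebesgue Q))"
    using QN QL v C q
    by (simp add: emeasure_eq_measure2 ennpow_ennreal divide_ennreal flip: ennreal_mult)
  also have "measure ?N Q powr (1 / p) * (C * ?q * measure ?N Q powr (1 / ?q) / v / measure lebesgue Q)
      = C * ?q * (measure ?N Q powr (1 / p) * measure ?N Q powr (1 / ?q)) / (v * measure lebesgue Q)"
    by (simp add: field_simps)
  also have "measure ?N Q powr (1 / p) * measure ?N Q powr (1 / ?q) = measure ?N Q"
    using Qpos q(2) by (simp flip: powr_add)
  also have "v * measure lebesgue Q = measure ?N Q" using QL by (simp add: v_def)
  also have "C * ?q * measure ?N Q / measure ?N Q = ?q * C" using Qpos by simp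
  finally show "ennpow (emeasure ?N Q) (1 / p) * (lorentz_inf ?q w ?F / emeasure lebesgue Q) \<le> ennreal (?q * C)" .
qed

theorem theorem4p10:
  fixes p :: real
  assumes "1 < p"
  shows "(\<exists>c::real. 0 < c \<and>
            (\<forall>u :: real ^ 'n::finite \<Rightarrow> real. weight u \<longrightarrow> u \<in> ApR p \<longrightarrow>
              (\<forall>f :: real ^ 'n \<Rightarrow> real. f \<in> borel_measurable lebesgue \<longrightarrow>
                 lorentz_inf (conj_exp p) u (\<lambda>x. maximal (\<lambda>y. f y * u y) x / ennreal (u x))
                 \<le> ennreal c * ennpow (ApR_const p u) (p + 1)
                     * lorentz_1 (conj_exp p) u (\<lambda>x. ennreal \<bar>f x\<bar>))))
       \<and> (\<forall>u :: real ^ 'n \<Rightarrow> real. weight u \<longrightarrow>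
            (\<forall>C::real. 0 < C \<longrightarrow>
              (\<forall>f :: real ^ 'n \<Rightarrow> real. f \<in> borel_measurable lebesgue \<longrightarrow>
                 lorentz_inf (conj_exp p) u (\<lambda>x. maximal (\<lambda>y. f y * u y) x / ennreal (u x))
                 \<le> ennreal C * lorentz_1 (conj_exp p) u (\<lambda>x. ennreal \<bar>f x\<bar>)) \<longrightarrow>
              u \<in> ApR p \<and> ApR_const p u \<le> ennreal (conj_exp p * C)))"
proof (rule conjI)
  show "\<exists>c::real. 0 < c \<and>
            (\<forall>u :: real ^ 'n \<Rightarrow> real. weight u \<longrightarrow> u \<in> ApR p \<longrightarrow>
              (\<forall>f :: real ^ 'n \<Rightarrow> real. f \<in> borel_measurable lebesgue \<longrightarrow>
                 lorentz_inf (conj_exp p) u (\<lambda>x. maximal (\<lambda>y. f y * u y) x / ennreal (u x))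
                 \<le> ennreal c * ennpow (ApR_const p u) (p + 1)
                     * lorentz_1 (conj_exp p) u (\<lambda>x. ennreal \<bar>f x\<bar>)))"
  proof (intro exI[of _ "maximal_const p CARD('n)"] conjI allI impI)
    show "0 < maximal_const p CARD('n)" by (rule maximal_const_pos[OF assms])
    fix u f :: "real ^ 'n \<Rightarrow> real"
    assume u: "weight u" "u \<in> ApR p" and f: "f \<in> borel_measurable lebesgue"
    obtain a where "0 \<le> a" "ApR_const p u = ennreal a"
      using u(2) by (cases "ApR_const p u") (auto simp: ApR_def)
    then show "lorentz_inf (conj_exp p) u (\<lambda>x. maximal (\<lambda>y. f y * u y) x / ennreal (u x))
                 \<le> ennreal (maximal_const p CARD('n)) * ennpow (ApR_const p u) (p + 1)
                     * lorentz_1 (conj_exp p) u (\<lambda>x. ennreal \<bar>f x\<bar>)"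
      by (rule maximal_weak_bound[OF u(1) assms _ _ f])
  qed
  have "u \<in> ApR p \<and> ApR_const p u \<le> ennreal (conj_exp p * C)"
    if "weight u" "0 < C" and
      "\<And>f. f \<in> borel_measurable lebesgue \<Longrightarrow>
         lorentz_inf (conj_exp p) u (\<lambda>x. maximal (\<lambda>y. f y * u y) x / ennreal (u x))
         \<le> ennreal C * lorentz_1 (conj_exp p) u (\<lambda>x. ennreal \<bar>f x\<bar>)"
    for u :: "real ^ 'n \<Rightarrow> real" and C :: real
  proof -
    have "ApR_const p u \<le> ennreal (conj_exp p * C)"
      by (rule ApR_const_le_of_weak_bound[OF that(1) assms that(2,3)])
    then show ?thesis
      using that(1) by (auto simp: ApR_def intro: le_less_trans)
  qed
  then show "\<forall>u :: real ^ 'n \<Rightarrow> real. weight u \<longrightarrow>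
            (\<forall>C::real. 0 < C \<longrightarrow>
              (\<forall>f :: real ^ 'n \<Rightarrow> real. f \<in> borel_measurable lebesgue \<longrightarrow>
                 lorentz_inf (conj_exp p) u (\<lambda>x. maximal (\<lambda>y. f y * u y) x / ennreal (u x))
                 \<le> ennreal C * lorentz_1 (conj_exp p) u (\<lambda>x. ennreal \<bar>f x\<bar>)) \<longrightarrow>
              u \<in> ApR p \<and> ApR_const p u \<le> ennreal (conj_exp p * C))"
    by blast
qed

end
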